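(* Let the standing assumptions in the context hold, and suppose the Lasso block oracle problem has a unique solution for every weight vector $w\in\mathbb{R}^D_+$ with $w_{\mathcal{S}^c}=0$. Fix $\rho\ge 0$. Let $\widehat\beta^{(1)},\widehat\beta^{(2)}$ be the results of the first and second LLA steps started from $\widehat\beta^{(0)}$. Suppose (i) $\lambda_{(K)}(\mathcal{L}(|\widehat\beta^{(0)}|))\le b_1\tau$ and $\lambda_{(K+1)}(\mathcal{L}(|\widehat\beta^{(0)}|))\ge b_2\tau$; (ii) $\displaystyle \frac{\|\mathcal{L}(|\widehat\beta^{(0)}|-|\beta^*|)\|_{op}}{\Delta}\le \min\Big(\rho,\ \frac1{2^6}\sqrt{\frac{a_1}{a_0 d_{\max}}}\Big)$; (iii) every $\beta\in\mathcal{B}^{op}_{\rho,\tau}$ satisfies $\|\nabla_{\mathcal{S}^c}\ell(\beta)\|_{\max}<\dfrac{a_1\tau}{4d_{\max}}$. Then $\widehat\beta^{(1)}\in\mathcal{B}^{op}_{\rho,\tau}$. If additionally (iv) every $\beta\in\mathcal{B}^{op}_{\rho,\tau}$ satisfies $\min_{k\in[K_{nz}]}\lambda_{(2)}(\mathcal{L}(|\beta_{C_k}|))\ge b_2\tau$, then $\widehat\beta^{(2)}=\widehat\beta^{o}$; furthermore taking an additional LLA step from $\widehat\beta^{(2)}$ results in the same estimate, i.e. the LLA algorithm has converged to the block oracle estimate. Moreover, suppose instead that (i) holds, that $$\min\Big(\|\mathcal{L}(|\widehat\beta^{(0)}|-|\beta^*|)\|_F,\ K^{1/2}\|\mathcal{L}(|\widehat\beta^{(0)}|-|\beta^*|)\|_{op}\Big)\le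 \Delta\cdot\min\Big(\rho,\ \frac1{2^6}\sqrt{\frac{a_1}{a_0d_{\max}}}\Big),$$ and that every $\beta\in\mathcal{B}^{F}_{\rho,\tau}$ satisfies $\|\nabla_{\mathcal{S}^c}\ell(\beta)\|_{\max}<\dfrac{a_1\tau}{4d_{\max}}$. Then $\widehat\beta^{(1)}\in\mathcal{B}^{F}_{\rho,\tau}$. If additionally every $\beta\in\mathcal{B}^{F}_{\rho,\tau}$ satisfies $\min_{k\in[K_{nz}]}\lambda_{(2)}(\mathcal{L}(|\beta_{C_k}|))\ge b_2\tau$, then $\widehat\beta^{(2)}=\widehat\beta^{o}$, and furthermore taking an additional LLA step from $\widehat\beta^{(2)}$ results in the same estimate, i.e. the LLA algorithm has converged to the block oracle estimate.
   Context: Notation. $D=\binom d2$; vectors $x\in\mathbb{R}^D$ are indexed by unordered pairs $(ij)$, $i\ne j\in[d]$. $\mathcal{A}(x)\in\mathbb{R}^{d\times d}$ is the symmetric matrix with zero diagonal and entries $\mathcal{A}(x)_{ij}=x_{(ij)}$; $\mathcal{L}(x)=\mathrm{diag}(\mathcal{A}(x)\mathbf 1_d)-\mathcal{A}(x)$ is its Laplacian. $|x|$ is the entrywise absolute value, $\|x\|_{\max}=\max_\ell|x_\ell|$, $\|\cdot\|_{op}$ the spectral norm, $\|\cdot\|_F$ the Frobenius norm, and $\lambda_{(j)}$ the $j$-th smallest eigenvalue of a symmetric matrix. The connected components of $x$ are those of the graph on $[d]$ with edge $ij$ iff $x_{(ij)}\neq0$ (isolated vertices count). SCAD-like penalty.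 Given $a_0\ge a_1>0$, $b_2>b_1>0$ and a tuning parameter $\tau$, $g_\tau:[0,\infty)\to\mathbb{R}$ satisfies: (1) $g_\tau$ is increasing and concave with $g_\tau(0)=0$; (2) $g_\tau$ is differentiable on $(0,\infty)$, and $g_\tau'(0):=g_\tau'(0+)=a_0\tau$; (3) $g_\tau'(t)\ge a_1\tau$ for $t\in(0,b_1\tau]$; (4) $g_\tau'(t)=0$ for $t\ge b_2\tau$. LLA step. For $V\in\mathbb{R}^{d\times m}$ and $w\in\mathbb{R}^m$ let $\mathcal{M}(V,w)_{(ij)}=\sum_k w_k(V_{ik}-V_{jk})^2$. An LLA step from $b$: let $V$ be an orthonormal matrix of eigenvectors of $\mathcal{L}(|b|)$ with eigenvalues $\lambda$, put $M=\mathcal{M}(V,g'_\tau(\lambda))$; the result is the minimizer over $\beta\in\mathbb{R}^D$ of $\ell(\beta)+\frac12\sum_{(ij)}M_{(ij)}|\beta_{(ij)}|$. The LLA algorithm iterates this step. Target and oracle. $\beta^*\in\mathbb{R}^D$, $\beta^*\neq0$, is a fixed target; $K$ is its number of connected components (isolated vertices included), $d_{\max}$ the largest number of nodes in a component, $\mathcal{S}$ the set of pairs $(ij)$, $i\ne j$, in the same component, $\mathcal{S}^c$ its complement, and $C_1,\dots,C_{K_{nz}}$ the components with at least two nodes. $\beta_{C_k}$ is the restriction of $\beta$ to pairs inside $C_k$, with $|C_k|\times|C_k|$ Laplacian $\mathcal{L}(|\beta_{C_k}|)$. The target gap is $\Delta=\lambda_{(K+1)}(\mathcal{L}(|\beta^*|))=\min_{k}\lambda_{(2)}(\mathcal{L}(|\beta^*_{C_k}|))$.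 The block oracle $\widehat\beta^{o}$ is the minimizer of $\ell(\beta)$ subject to $\beta_{\mathcal{S}^c}=0$. Lasso block oracle problem with weight $w\in\mathbb{R}^D_+$, $w_{\mathcal{S}^c}=0$: minimize $\ell(\beta)+\frac12\sum_{(ij)\in\mathcal{S}}w_{(ij)}|\beta_{(ij)}|$ subject to $\beta_{\mathcal{S}^c}=0$. $\mathcal{B}^{op}_{\rho,\tau}$ is the set of all minimizers of this problem over weights $w\in\mathbb{R}^D_+$ with $w_{\mathcal{S}^c}=0$ and $\|w\|_{\max}\le 2^5a_0\tau\rho^2$. $\mathcal{B}^{F}_{\rho,\tau}$ is the set of all minimizers over weights $w\in\mathbb{R}^D_+$ with $w_{\mathcal{S}^c}=0$, $\|w\|_{\max}\le2^5a_0\tau\rho^2$, $\|w\|_2\le2^{9/2}d_{\max}^{1/2}a_0\tau\rho^2$ and $\|w\|_1\le2^4d_{\max}a_0\tau\rho^2$. Standing assumptions. $\ell:\mathbb{R}^D\to\mathbb{R}$ is convex (and differentiable); $g_\tau$ is SCAD-like, i.e. $g_\tau$ is increasing and concave on $[0,\infty)$ with $g_\tau(0)=0$, is differentiable on $(0,\infty)$ with $g_\tau'(0):=g_\tau'(0+)=a_0\tau$, and satisfies $g_\tau'(t)\ge a_1\tau$ for $t\in(0,b_1\tau]$ and $g_\tau'(t)=0$ for $t\ge b_2\tau$; and the block oracle problem has the unique solution $\widehat\beta^{o}$, which satisfies $\nabla_{\mathcal{S}}\ell(\widehat\beta^{o})=0$. *)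

theory Defs
  imports "HOL-Analysis.Analysis"
begin

text \<open>
  The nodes \<open>[d]\<close> are the elements of a finite type \<open>'n\<close>, so \<open>d = CARD('n)\<close>. The class \<open>card2\<close>
  only says \<open>d \<ge> 2\<close>, i.e. that there is at least one pair (which a nonzero target forces anyway).
  A vector in \<open>\<real>\<^sup>D\<close> with \<open>D = d choose 2\<close> has type \<open>real^('n edge)\<close>; \<open>\<bar>x\<bar>\<close> and \<open>0 \<le> x\<close> on it are
  entrywise, \<open>norm\<close> is the Euclidean norm and \<open>infnorm\<close> is the maximum norm.
\<close>

typedef (overloaded) ('n::card2) edge = "{e :: 'n set. card e = 2}"
  morphisms endpoints Edge
proof -
  have "2 \<le> card (UNIV :: 'n set)" by (rule two_le_card)
  then obtain e :: "'n set" where "card e = 2"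
    by (metis obtain_subset_with_card_n)
  then show ?thesis by blast
qed

instance edge :: (card2) finite
proof
  have "inj (endpoints :: 'a edge \<Rightarrow> 'a set)"
    by (simp add: endpoints_inject inj_def)
  then show "finite (UNIV :: 'a edge set)"
    by (rule finite_imageD[rotated]) simp
qed

definition edge_between :: "'n::card2 \<Rightarrow> 'n \<Rightarrow> 'n edge" where
  "edge_between i j = Edge {i, j}"

text \<open>The vector with entry \<open>f i j\<close> at \<open>(ij)\<close>; only used for symmetric \<open>f\<close>, see \<open>edge_vec_nth\<close>.\<close>

definition edge_vec :: "('n::card2 \<Rightarrow> 'n \<Rightarrow> real) \<Rightarrow> real^('n edge)" where
  "edge_vec f = (\<chi> e. case (SOME p. endpoints e = {fst p, snd p}) of (i, j) \<Rightarrow> f i j)"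

lemma edge_vec_nth:
  assumes "\<And>i j. f i j = f j i" and "i \<noteq> j"
  shows "edge_vec f $ edge_between i j = f i j"
proof -
  have e: "endpoints (edge_between i j) = {i, j}"
    using assms(2) by (simp add: edge_between_def Edge_inverse)
  define p where "p = (SOME p. endpoints (edge_between i j) = {fst p, snd p})"
  have "endpoints (edge_between i j) = {fst p, snd p}"
    unfolding p_def by (rule someI[of _ "(i, j)"]) (simp add: e)
  then have "(fst p = i \<and> snd p = j) \<or> (fst p = j \<and> snd p = i)"
    by (metis e doubleton_eq_iff)
  then have "f (fst p) (snd p) = f i j"
    using assms(1) by auto
  then show ?thesis
    by (simp add: edge_vec_def p_def case_prod_beta)
qed

definition restr :: "'i::finite set \<Rightarrow> real^'i \<Rightarrow> real^'i" where
  "restr S x = (\<chi> e. if e \<in> S then x $ e else 0)"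

definition adjacency :: "real^('n::card2 edge) \<Rightarrow> real^('n::card2)^('n::card2)" where
  "adjacency x = (\<chi> i j. if i = j then 0 else x $ edge_between i j)"

definition laplacian :: "real^('n::card2 edge) \<Rightarrow> real^('n::card2)^('n::card2)" where
  "laplacian x = (\<chi> i j. if i = j then (adjacency x *v 1) $ i else 0) - adjacency x"

definition op_norm :: "real^'n^'m \<Rightarrow> real" where
  "op_norm A = onorm (\<lambda>v. A *v v)"

lemma norm_frobenius: "norm (A :: real^'n^'m) = sqrt (\<Sum>i\<in>UNIV. \<Sum>j\<in>UNIV. (A $ i $ j)\<^sup>2)"
  by (simp add: norm_vec_def L2_set_def sum_nonneg)

text \<open>
  To cover the \<open>|C| \<times> |C|\<close> Laplacian of a component \<open>C\<close> without a type depending on \<open>C\<close>, eigenvalues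
  are defined for the principal submatrix \<open>(A\<^sub>i\<^sub>j)\<close>, \<open>i, j \<in> C\<close>: its eigenvectors are vectors supported
  on \<open>C\<close>. The full matrix is the case \<open>C = UNIV\<close>. Multiplicities are dimensions of
  eigenspaces, which for symmetric matrices (the only ones used) are also the algebraic ones.
\<close>

definition eigenspace_on :: "'n set \<Rightarrow> real^'n^'n \<Rightarrow> real \<Rightarrow> (real^'n) set" where
  "eigenspace_on C A c =
     {v. (\<forall>i. i \<notin> C \<longrightarrow> v $ i = 0) \<and> (\<forall>i\<in>C. (\<Sum>j\<in>C. A $ i $ j * v $ j) = c * v $ i)}"

definition eigvals_on :: "'n set \<Rightarrow> real^'n^'n \<Rightarrow> real list" where
  "eigvals_on C A = sorted_list_of_multiset
     (\<Sum>c | eigenspace_on C A c \<noteq> {0}. replicate_mset (dim (eigenspace_on C A c)) c)"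

text \<open>The \<open>j\<close>-th smallest eigenvalue, counting from \<open>j = 1\<close>.\<close>

definition eigval_on :: "'n set \<Rightarrow> nat \<Rightarrow> real^'n^'n \<Rightarrow> real" where
  "eigval_on C j A = eigvals_on C A ! (j - 1)"

abbreviation eigval :: "nat \<Rightarrow> real^'n^'n \<Rightarrow> real" where
  "eigval \<equiv> eigval_on UNIV"

definition components_of :: "real^('n::card2 edge) \<Rightarrow> 'n set set" where
  "components_of x = UNIV // {(i, j). adjacency x $ i $ j \<noteq> 0}\<^sup>*"

definition nontrivial_components :: "real^('n::card2 edge) \<Rightarrow> 'n set set" where
  "nontrivial_components x = {C \<in> components_of x. 2 \<le> card C}"

definition num_components :: "real^('n::card2 edge) \<Rightarrow> nat" where
  "num_components x = card (components_of x)"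

definition max_component :: "real^('n::card2 edge) \<Rightarrow> nat" where
  "max_component x = (MAX C\<in>components_of x. card C)"

definition pairs_in :: "'n::card2 set \<Rightarrow> 'n edge set" where
  "pairs_in C = {e. endpoints e \<subseteq> C}"

definition same_component :: "real^('n::card2 edge) \<Rightarrow> 'n edge set" where
  "same_component x = (\<Union>C\<in>components_of x. pairs_in C)"

definition target_gap :: "real^('n::card2 edge) \<Rightarrow> real" where
  "target_gap x = eigval (num_components x + 1) (laplacian \<bar>x\<bar>)"

definition min_component_gap :: "real^('n::card2 edge) \<Rightarrow> real^('n edge) \<Rightarrow> real" where
  "min_component_gap target x =
     (MIN C\<in>nontrivial_components target. eigval_on C 2 (laplacian \<bar>restr (pairs_in C) x\<bar>))"

text \<open>
  \<open>g\<close> matters on \<open>[0, \<infinity>)\<close> only. There \<open>g'(0)\<close> is by convention the right limit \<open>g'(0+) = a0 * \<tau>\<close>, which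
  \<open>deriv g 0\<close> does not give. Increasing means nondecreasing, since \<open>g'\<close> vanishes beyond \<open>b2 * \<tau>\<close>.
\<close>

definition penalty_deriv :: "real \<Rightarrow> real \<Rightarrow> (real \<Rightarrow> real) \<Rightarrow> real \<Rightarrow> real" where
  "penalty_deriv a0 \<tau> g t = (if t = 0 then a0 * \<tau> else deriv g t)"

definition scad_like :: "real \<Rightarrow> real \<Rightarrow> real \<Rightarrow> real \<Rightarrow> real \<Rightarrow> (real \<Rightarrow> real) \<Rightarrow> bool" where
  "scad_like a0 a1 b1 b2 \<tau> g \<longleftrightarrow>
     mono_on {0..} g \<and> concave_on {0..} g \<and> g 0 = 0 \<and>
     (\<forall>t>0. g differentiable (at t)) \<and> (deriv g \<longlongrightarrow> a0 * \<tau>) (at_right 0) \<and>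
     (\<forall>t\<in>{0<..b1 * \<tau>}. a1 * \<tau> \<le> penalty_deriv a0 \<tau> g t) \<and>
     (\<forall>t\<ge>0. b2 * \<tau> \<le> t \<longrightarrow> penalty_deriv a0 \<tau> g t = 0)"

definition gradient :: "('a::real_inner \<Rightarrow> real) \<Rightarrow> 'a \<Rightarrow> 'a" where
  "gradient f x = (THE D. GDERIV f x :> D)"

text \<open>
  The matrix \<open>\<M>(V, w)\<close>. For an eigenbasis \<open>V\<close> of \<open>A\<close> with eigenvalues \<open>\<lambda>\<close> and \<open>w = f(\<lambda>)\<close> its entry at
  \<open>(ij)\<close> is the quadratic form of \<open>f(A)\<close> at the difference of two unit vectors, so the choice of the
  eigenbasis in \<open>lla_step\<close> is immaterial.
\<close>

definition eig_weights :: "real^'m^('n::card2) \<Rightarrow> real^'m \<Rightarrow> real^('n edge)" where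
  "eig_weights V w = edge_vec (\<lambda>i j. \<Sum>k\<in>UNIV. w $ k * (V $ i $ k - V $ j $ k)\<^sup>2)"

definition eigen_decomp :: "real^'n^'n \<Rightarrow> real^'n^'n \<Rightarrow> real^'n \<Rightarrow> bool" where
  "eigen_decomp A V ev \<longleftrightarrow>
     orthogonal_matrix V \<and> (\<forall>k. A *v column k V = ev $ k *\<^sub>R column k V)"

definition weighted_l1 :: "'i::finite set \<Rightarrow> real^'i \<Rightarrow> real^'i \<Rightarrow> real" where
  "weighted_l1 S w x = 1 / 2 * (\<Sum>e\<in>S. w $ e * \<bar>x $ e\<bar>)"

text \<open>
  \<open>lla_step l g' b \<beta>\<close> says that \<open>\<beta>\<close> is a result of the LLA step from \<open>b\<close>, where \<open>g'\<close> is the derivative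
  of the penalty. Uniqueness of the minimizer is not part of this relation.
\<close>

definition lla_step ::
  "(real^('n::card2 edge) \<Rightarrow> real) \<Rightarrow> (real \<Rightarrow> real) \<Rightarrow> real^('n edge) \<Rightarrow> real^('n edge) \<Rightarrow> bool" where
  "lla_step l g' b \<beta> \<longleftrightarrow>
     (\<exists>V ev. eigen_decomp (laplacian \<bar>b\<bar>) V ev \<and>
        is_arg_min (\<lambda>\<beta>. l \<beta> + weighted_l1 UNIV (eig_weights V (\<chi> k. g' (ev $ k))) \<beta>)
          (\<lambda>_. True) \<beta>)"

definition block_oracle ::
  "(real^'i::finite \<Rightarrow> real) \<Rightarrow> 'i set \<Rightarrow> real^'i \<Rightarrow> bool" where
  "block_oracle l S \<beta> \<longleftrightarrow> is_arg_min l (\<lambda>\<beta>. restr (- S) \<beta> = 0) \<beta>"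

definition lasso_oracle ::
  "(real^'i::finite \<Rightarrow> real) \<Rightarrow> 'i set \<Rightarrow> real^'i \<Rightarrow> real^'i \<Rightarrow> bool" where
  "lasso_oracle l S w \<beta> \<longleftrightarrow>
     is_arg_min (\<lambda>\<beta>. l \<beta> + weighted_l1 S w \<beta>) (\<lambda>\<beta>. restr (- S) \<beta> = 0) \<beta>"

definition B_op ::
  "(real^('n::card2 edge) \<Rightarrow> real) \<Rightarrow> real^('n edge) \<Rightarrow> real \<Rightarrow> real \<Rightarrow> real \<Rightarrow> (real^('n edge)) set" where
  "B_op l target a0 \<rho> \<tau> =
     {\<beta>. \<exists>w. 0 \<le> w \<and> restr (- same_component target) w = 0 \<and>
          infnorm w \<le> 2 ^ 5 * a0 * \<tau> * \<rho>\<^sup>2 \<and>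
          lasso_oracle l (same_component target) w \<beta>}"

definition B_F ::
  "(real^('n::card2 edge) \<Rightarrow> real) \<Rightarrow> real^('n edge) \<Rightarrow> real \<Rightarrow> real \<Rightarrow> real \<Rightarrow> (real^('n edge)) set" where
  "B_F l target a0 \<rho> \<tau> =
     {\<beta>. \<exists>w. 0 \<le> w \<and> restr (- same_component target) w = 0 \<and>
          infnorm w \<le> 2 ^ 5 * a0 * \<tau> * \<rho>\<^sup>2 \<and>
          norm w \<le> 2 powr (9 / 2) * sqrt (real (max_component target)) * a0 * \<tau> * \<rho>\<^sup>2 \<and>
          (\<Sum>e\<in>UNIV. \<bar>w $ e\<bar>) \<le> 2 ^ 4 * real (max_component target) * a0 * \<tau> * \<rho>\<^sup>2 \<and>
          lasso_oracle l (same_component target) w \<beta>}"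

end

theory Submission
  imports Defs
begin

text \<open>
  Write \<open>L\<close> for the Laplacian of \<open>\<bar>\<beta>0\<bar>\<close>, \<open>N\<close> for that of \<open>\<bar>target\<bar>\<close>, \<open>E = L - N\<close>, and let \<open>P\<close> be the orthogonal
  projection onto the span of the eigenvectors of \<open>L\<close> with eigenvalue at most \<open>b1 * \<tau>\<close>. By (i) there are
  exactly \<open>K\<close> of them, and every other eigenvalue is at least \<open>b2 * \<tau>\<close>, where the derivative of the
  penalty vanishes. On the small eigenvalues that derivative lies between \<open>a1 * \<tau>\<close> and \<open>a0 * \<tau>\<close>. The
  weight of the first LLA step at a pair \<open>(ij)\<close> is therefore comparable to \<open>\<parallel>P x\<parallel>\<^sup>2\<close> with
  \<open>x = e\<^sub>i - e\<^sub>j\<close>.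

  The kernel of \<open>N\<close> consists of the vectors that are constant on the components of the target. It has
  dimension \<open>K\<close> too, and a Weyl and Davis--Kahan argument shows that \<open>P\<close> almost fixes it when
  \<open>\<parallel>E\<parallel>\<close> is small compared with the gap \<open>\<Delta>\<close>. If \<open>i\<close> and \<open>j\<close> lie in one component, \<open>x\<close> is orthogonal to
  the kernel, so \<open>\<parallel>P x\<parallel>\<^sup>2\<close> is of order \<open>\<rho>\<^sup>2\<close>; if they do not, pairing \<open>P x\<close> with the indicator of the
  component of \<open>i\<close> shows that \<open>\<parallel>P x\<parallel>\<^sup>2\<close> is at least \<open>1 / (2 * dmax)\<close>, where \<open>dmax\<close> is the size of the
  largest component. These are
  \<open>weight_within_component\<close> and \<open>weight_between_components\<close>. For the Frobenius version, the sum of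
  \<open>\<parallel>P x\<parallel>\<^sup>2\<close> over the pairs inside components is controlled by the squared Frobenius norm of \<open>(I - Q) P\<close>,
  with \<open>Q\<close> the projection onto the kernel, which equals that of \<open>(I - P) Q\<close> because both projections
  have rank \<open>K\<close> (\<open>weight_l1_within_components\<close>).

  Restricting the weights to pairs inside components gives a Lasso block oracle problem whose solution
  belongs to the set \<open>\<B>\<close> of the hypotheses. Between components the weights dominate the gradient at that
  solution, so by convexity the solution is also optimal without the support constraint, and every
  unconstrained minimizer has the block support (\<open>penalized_arg_min_iff_lasso_oracle\<close>). This places the
  result of the first step in \<open>\<B>\<close>.

  For a vector with the block support whose component gaps are at least \<open>b2 * \<tau>\<close>, every eigenvector of
  the Laplacian is either constant on components with eigenvalue \<open>0\<close> or has an eigenvalue where the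
  penalty is flat. The weights then vanish exactly inside components and are at least
  \<open>a0 * \<tau> / dmax\<close> between them, so the same optimality criterion returns the block oracle
  (\<open>lla_step_from_well_separated_blocks\<close>). This applies to the result of the first step and to the block
  oracle itself, which is the member of \<open>\<B>\<close> with weight \<open>0\<close>.
\<close>

section \<open>Orthonormal bases and the spectral theorem\<close>

locale orthonormal_basis =
  fixes u :: "'n::finite \<Rightarrow> real^'n"
  assumes orthonormal: "u a \<bullet> u b = (if a = b then 1 else 0)"
begin

lemma norm_basis [simp]: "norm (u a) = 1"
  by (simp add: norm_eq_1 orthonormal)

lemma inj_basis: "inj u"
  by (rule injI) (metis orthonormal zero_neq_one)

lemma independent_basis: "independent (u ` I)"
proof (rule pairwise_orthogonal_independent)
  show "pairwise orthogonal (u ` I)"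
    by (auto simp: pairwise_def orthogonal_def orthonormal)
  show "0 \<notin> u ` I"
    by (metis imageE norm_basis norm_zero zero_neq_one)
qed

lemma dim_basis_image: "dim (u ` I) = card I"
proof -
  have "inj_on u I"
    using inj_basis by (rule inj_on_subset) simp
  then show ?thesis
    by (simp add: dim_eq_card_independent[OF independent_basis] card_image)
qed

lemma span_basis: "span (range u) = UNIV"
proof -
  have "dim (range u) = DIM(real^'n)"
    by (simp add: dim_basis_image)
  then show ?thesis
    by (simp only: dim_eq_full)
qed

lemma expansion: "x = (\<Sum>k\<in>UNIV. (x \<bullet> u k) *\<^sub>R u k)"
proof -
  let ?y = "x - (\<Sum>k\<in>UNIV. (x \<bullet> u k) *\<^sub>R u k)"
  have "?y \<bullet> u a = 0" for a
    by (simp add: inner_diff_left inner_sum_left orthonormal if_distrib[of "times _"] cong: if_cong)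
  then have "\<And>y. y \<in> range u \<Longrightarrow> orthogonal ?y y"
    by (auto simp: orthogonal_def)
  moreover have "?y \<in> span (range u)"
    by (simp add: span_basis)
  ultimately have "orthogonal ?y ?y"
    by (rule orthogonal_to_span[rotated])
  then show ?thesis
    by (simp only: orthogonal_self right_minus_eq)
qed

lemma parseval_inner: "x \<bullet> y = (\<Sum>k\<in>UNIV. (x \<bullet> u k) * (y \<bullet> u k))"
proof -
  have "x \<bullet> y = (\<Sum>k\<in>UNIV. (x \<bullet> u k) *\<^sub>R u k) \<bullet> y"
    using expansion[of x] by simp
  then show ?thesis
    by (simp add: inner_sum_left inner_commute[of y])
qed

lemma parseval: "(norm x)\<^sup>2 = (\<Sum>k\<in>UNIV. (x \<bullet> u k)\<^sup>2)"
  unfolding power2_norm_eq_inner by (subst parseval_inner) (simp add: power2_eq_square)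

lemma span_basis_iff: "x \<in> span (u ` I) \<longleftrightarrow> (\<forall>k. k \<notin> I \<longrightarrow> x \<bullet> u k = 0)"
proof
  assume x: "x \<in> span (u ` I)"
  show "\<forall>k. k \<notin> I \<longrightarrow> x \<bullet> u k = 0"
  proof (intro allI impI)
    fix k assume "k \<notin> I"
    then have "orthogonal (u k) y" if "y \<in> u ` I" for y
      using that by (auto simp: orthogonal_def orthonormal)
    then have "orthogonal (u k) x"
      using orthogonal_to_span[OF x] by blast
    then show "x \<bullet> u k = 0"
      by (simp add: orthogonal_def inner_commute)
  qed
next
  assume k: "\<forall>k. k \<notin> I \<longrightarrow> x \<bullet> u k = 0"
  have "(\<Sum>k\<in>UNIV. (x \<bullet> u k) *\<^sub>R u k) \<in> span (u ` I)"
  proof (rule span_sum)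
    fix a show "(x \<bullet> u a) *\<^sub>R u a \<in> span (u ` I)"
      using k by (cases "a \<in> I") (auto intro: span_scale span_base span_zero)
  qed
  then show "x \<in> span (u ` I)"
    using expansion[of x] by simp
qed

lemma inner_family_sum:
  "(\<Sum>k\<in>I. (x \<bullet> u k) *\<^sub>R u k) \<bullet> u a = (if a \<in> I then x \<bullet> u a else 0)"
  by (simp add: inner_sum_left orthonormal if_distrib[of "times _"] sum.delta cong: if_cong)

end

text \<open>
  The dimension count behind every min-max argument on eigenvalues.
\<close>

lemma exists_orthogonal_in_larger_span:
  fixes X Y :: "'a::euclidean_space set"
  assumes "subspace X" "subspace Y" "dim Y < dim X"
  obtains x where "x \<in> X" "x \<noteq> 0" "\<And>y. y \<in> Y \<Longrightarrow> x \<bullet> y = 0"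
proof -
  let ?P = "{x. \<forall>y\<in>Y. orthogonal y x}"
  have P: "subspace ?P"
    by (auto simp: subspace_def orthogonal_def inner_add_right)
  have "dim ?P + dim Y = DIM('a)"
    using dim_subspace_orthogonal_to_vectors[OF assms(2) subspace_UNIV] by simp
  moreover have "dim {x + y |x y. x \<in> X \<and> y \<in> ?P} \<le> DIM('a)"
    by (rule dim_subset_UNIV)
  moreover have "dim {x + y |x y. x \<in> X \<and> y \<in> ?P} + dim (X \<inter> ?P) = dim X + dim ?P"
    using dim_sums_Int[OF assms(1) P] by simp
  ultimately have "dim (X \<inter> ?P) \<noteq> 0"
    using assms(3) by linarith
  then have "\<not> X \<inter> ?P \<subseteq> {0}"
    by (simp only: dim_eq_0 not_False_eq_True)
  then obtain x where "x \<in> X \<inter> ?P" "x \<noteq> 0"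
    by blast
  then show ?thesis
    using that by (auto simp: orthogonal_def inner_commute)
qed

lemma symmetric_matrix_inner:
  fixes A :: "real^'n^'n"
  assumes "transpose A = A"
  shows "x \<bullet> (A *v y) = (A *v x) \<bullet> y"
  by (metis assms dot_lmul_matrix transpose_matrix_vector)

text \<open>
  A maximizer of the quadratic form on the unit sphere of the subspace is an eigenvector, since
  otherwise the form would grow to first order along the residual.
\<close>

lemma symmetric_invariant_subspace_eigenvector:
  fixes A :: "real^'n^'n"
  assumes A: "transpose A = A" and W: "subspace W" and inv: "\<And>x. x \<in> W \<Longrightarrow> A *v x \<in> W"
    and "W \<noteq> {0}"
  obtains v c where "v \<in> W" "norm v = 1" "A *v v = c *\<^sub>R v"
proof -
  let ?K = "W \<inter> sphere 0 1" and ?q = "\<lambda>x. x \<bullet> (A *v x)"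
  have "compact ?K"
    using closed_subspace[OF W] by (simp add: closed_Int_compact)
  moreover obtain w where "w \<in> W" "w \<noteq> 0"
    using \<open>W \<noteq> {0}\<close> subspace_0[OF W] by blast
  then have "w /\<^sub>R norm w \<in> ?K"
    using W by (simp add: subspace_scale)
  then have "?K \<noteq> {}" by blast
  moreover have "continuous_on ?K ?q"
    by (intro continuous_intros matrix_vector_mult_linear_continuous_on)
  ultimately obtain v where v: "v \<in> ?K" and max: "\<And>y. y \<in> ?K \<Longrightarrow> ?q y \<le> ?q v"
    using continuous_attains_sup[of ?K ?q] by blast
  define c where "c = ?q v"
  have nv: "norm v = 1" "v \<in> W" using v by auto
  have q_le: "?q x \<le> c * (norm x)\<^sup>2" if "x \<in> W" for x
  proof (cases "x = 0")
    case False
    then have "x /\<^sub>R norm x \<in> ?K"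
      using that W by (simp add: subspace_scale)
    from max[OF this] have "?q x / (norm x)\<^sup>2 \<le> c"
      by (simp add: c_def matrix_vector_mult_scaleR power2_eq_square field_simps)
    then show ?thesis
      using False by (simp add: field_simps)
  qed simp
  define r where "r = A *v v - c *\<^sub>R v"
  have rW: "r \<in> W"
    unfolding r_def using nv inv W by (simp add: subspace_diff subspace_scale)
  have rv: "r \<bullet> v = 0"
  proof -
    have "r \<bullet> v = (A *v v) \<bullet> v - c * (v \<bullet> v)"
      by (simp add: r_def inner_diff_left)
    then show ?thesis
      using nv by (simp add: c_def inner_commute norm_eq_1)
  qed
  have rr: "r \<bullet> (A *v v) = r \<bullet> r"
  proof -
    have "A *v v = r + c *\<^sub>R v"
      by (simp add: r_def)
    then show ?thesis
      by (simp add: inner_add_right rv)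
  qed
  \<comment> \<open>Moving from \<open>v\<close> in the direction of the residual \<open>r\<close> increases the quotient to first order.\<close>
  have "r = 0"
  proof (rule ccontr)
    assume "r \<noteq> 0"
    then have pos: "0 < r \<bullet> r" by simp
    define b where "b = c * (r \<bullet> r) - ?q r"
    have ineq: "2 * t * (r \<bullet> r) \<le> t\<^sup>2 * b" for t
    proof -
      have "v + t *\<^sub>R r \<in> W"
        using nv rW W by (simp add: subspace_add subspace_scale)
      from q_le[OF this] have le: "?q (v + t *\<^sub>R r) \<le> c * (norm (v + t *\<^sub>R r))\<^sup>2" .
      have n: "(norm (v + t *\<^sub>R r))\<^sup>2 = 1 + t\<^sup>2 * (r \<bullet> r)"
        unfolding power2_norm_eq_inner using nv rv
        by (simp add: inner_add_left inner_add_right inner_commute norm_eq_1 power2_eq_square)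
      have "v \<bullet> (A *v r) = r \<bullet> r"
        using symmetric_matrix_inner[OF A, of v r] rr by (simp add: inner_commute)
      then have q: "?q (v + t *\<^sub>R r) = c + 2 * t * (r \<bullet> r) + t\<^sup>2 * ?q r"
        using rr by (simp add: c_def matrix_vector_right_distrib matrix_vector_mult_scaleR
            inner_add_left inner_add_right power2_eq_square algebra_simps)
      show ?thesis
        using le unfolding n q b_def by (simp add: algebra_simps)
    qed
    show False
    proof (cases "b \<le> 0")
      case True
      then show False using ineq[of 1] pos by simp
    next
      case False
      have "2 * (r \<bullet> r / b) * (r \<bullet> r) \<le> (r \<bullet> r / b) * (r \<bullet> r)"
        using ineq[of "r \<bullet> r / b"] False by (simp add: power2_eq_square)
      moreover have "0 < (r \<bullet> r / b) * (r \<bullet> r)"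
        using False pos by simp
      ultimately show False by linarith
    qed
  qed
  then show ?thesis
    using that[of v c] nv by (simp add: r_def)
qed

text \<open>
  Splitting off one eigenvector leaves an invariant subspace of smaller dimension, because the
  orthogonal complement of an eigenvector of a symmetric matrix is invariant.
\<close>

lemma symmetric_invariant_subspace_eigenbasis:
  fixes A :: "real^'n^'n"
  assumes A: "transpose A = A" and W: "subspace W" and inv: "\<And>x. x \<in> W \<Longrightarrow> A *v x \<in> W"
  shows "\<exists>B. pairwise orthogonal B \<and> (\<forall>v\<in>B. norm v = 1 \<and> (\<exists>c. A *v v = c *\<^sub>R v)) \<and> span B = W"
  using W inv
proof (induction "dim W" arbitrary: W rule: less_induct)
  case less
  show ?case
  proof (cases "W = {0}")
    case True
    then show ?thesis by (intro exI[of _ "{}"]) auto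
  next
    case False
    obtain v c where v: "v \<in> W" "norm v = 1" "A *v v = c *\<^sub>R v"
      using symmetric_invariant_subspace_eigenvector[OF A less.prems False] .
    define W' where "W' = {x \<in> W. v \<bullet> x = 0}"
    have W': "subspace W'"
      using less.prems(1) by (auto simp: W'_def subspace_def inner_add_right)
    have inv': "A *v x \<in> W'" if "x \<in> W'" for x
      using that less.prems(2) v(3) symmetric_matrix_inner[OF A, of v x] by (simp add: W'_def)
    have "W' \<subset> W"
    proof (rule psubsetI)
      show "W' \<noteq> W"
        using v by (auto simp: W'_def norm_eq_1 dest!: equalityD2)
    qed (auto simp: W'_def)
    then have "span W' \<subset> span W"
      using W' less.prems(1) by (simp only: span_eq_iff[THEN iffD2])
    then have "dim W' < dim W"
      by (rule dim_psubset)
    from less.hyps[OF this W' inv'] obtain B where B: "pairwise orthogonal B"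
      "\<forall>v\<in>B. norm v = 1 \<and> (\<exists>c. A *v v = c *\<^sub>R v)" "span B = W'"
      by blast
    have "v \<bullet> b = 0" if "b \<in> B" for b
      using that B(3) span_base[of b B] by (auto simp: W'_def)
    then have "pairwise orthogonal (insert v B)"
      using B(1) by (auto simp: pairwise_insert orthogonal_def inner_commute)
    moreover have "span (insert v B) = W"
    proof
      show "span (insert v B) \<subseteq> W"
      proof (rule span_minimal[OF _ less.prems(1)])
        show "insert v B \<subseteq> W"
          using v(1) B(3) span_superset[of B] by (auto simp: W'_def)
      qed
      show "W \<subseteq> span (insert v B)"
      proof
        fix x assume "x \<in> W"
        then have "x - (v \<bullet> x) *\<^sub>R v \<in> span B"
          using less.prems(1) v
          by (simp add: B(3) W'_def subspace_diff subspace_scale inner_diff_right norm_eq_1)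
        then show "x \<in> span (insert v B)"
          by (auto simp: span_insert)
      qed
    qed
    ultimately show ?thesis
      using B(2) v by (intro exI[of _ "insert v B"]) auto
  qed
qed

locale eigenbasis = orthonormal_basis u for u :: "'n::finite \<Rightarrow> real^'n" +
  fixes A :: "real^'n^'n" and ev :: "'n \<Rightarrow> real"
  assumes eigen: "A *v u k = ev k *\<^sub>R u k"
begin

lemma mult_inner_basis: "(A *v x) \<bullet> u k = ev k * (x \<bullet> u k)"
proof -
  have "A *v x = A *v (\<Sum>k\<in>UNIV. (x \<bullet> u k) *\<^sub>R u k)"
    using expansion[of x] by simp
  also have "\<dots> = (\<Sum>k\<in>UNIV. (x \<bullet> u k) *\<^sub>R ev k *\<^sub>R u k)"
    by (simp add: linear_sum[OF matrix_vector_mul_linear] matrix_vector_mult_scaleR eigen)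
  finally show ?thesis
    by (simp add: inner_sum_left orthonormal if_distrib[of "times _"] cong: if_cong)
qed

lemma quadratic_form: "x \<bullet> (A *v x) = (\<Sum>k\<in>UNIV. ev k * (x \<bullet> u k)\<^sup>2)"
  by (subst parseval_inner) (simp add: mult_inner_basis power2_eq_square algebra_simps)

lemma norm_mult_sq: "(norm (A *v x))\<^sup>2 = (\<Sum>k\<in>UNIV. (ev k)\<^sup>2 * (x \<bullet> u k)\<^sup>2)"
  by (simp add: parseval mult_inner_basis power_mult_distrib)

lemma eigenspace_eq_span: "eigenspace_on UNIV A c = span (u ` {k. ev k = c})"
proof -
  have "x \<in> eigenspace_on UNIV A c \<longleftrightarrow> A *v x = c *\<^sub>R x" for x
    by (simp add: eigenspace_on_def vec_eq_iff matrix_vector_mult_def)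
  also have "\<dots> x \<longleftrightarrow> (\<forall>k. ev k * (x \<bullet> u k) = c * (x \<bullet> u k))" for x
  proof
    assume "A *v x = c *\<^sub>R x"
    then show "\<forall>k. ev k * (x \<bullet> u k) = c * (x \<bullet> u k)"
      by (metis mult_inner_basis inner_scaleR_left)
  next
    assume *: "\<forall>k. ev k * (x \<bullet> u k) = c * (x \<bullet> u k)"
    have "(norm (A *v x - c *\<^sub>R x))\<^sup>2 = 0"
      unfolding parseval inner_diff_left mult_inner_basis
      using * by (intro sum.neutral) simp
    then show "A *v x = c *\<^sub>R x" by simp
  qed
  finally show ?thesis
    by (auto simp: span_basis_iff)
qed

lemma dim_eigenspace: "dim (eigenspace_on UNIV A c) = card {k. ev k = c}"
  by (simp only: eigenspace_eq_span dim_span dim_basis_image)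

end

theorem spectral_theorem:
  fixes A :: "real^'n^'n"
  assumes A: "transpose A = A"
  obtains u ev where "eigenbasis u A ev"
proof -
  obtain B :: "(real^'n) set" where B: "pairwise orthogonal B"
      "\<forall>v\<in>B. norm v = 1 \<and> (\<exists>c. A *v v = c *\<^sub>R v)" "span B = UNIV"
    using symmetric_invariant_subspace_eigenbasis[OF A subspace_UNIV] by auto
  have "independent B"
    by (rule pairwise_orthogonal_independent[OF B(1)]) (use B(2) in force)
  have "finite B"
    using \<open>independent B\<close> by (rule independent_imp_finite)
  have "dim B = DIM(real^'n)"
    using B(3) by (simp only: dim_eq_full)
  then have "card B = CARD('n)"
    using dim_eq_card_independent[OF \<open>independent B\<close>] by simp
  then obtain u where u: "bij_betw u (UNIV :: 'n set) B"
    using finite_same_card_bij[of "UNIV :: 'n set" B] \<open>finite B\<close> by auto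
  have uB: "u k \<in> B" for k
    using u by (auto simp: bij_betw_def)
  have "\<forall>k. \<exists>c. A *v u k = c *\<^sub>R u k"
    using B(2) uB by blast
  then obtain ev where ev: "\<And>k. A *v u k = ev k *\<^sub>R u k"
    by metis
  have "eigenbasis u A ev"
  proof
    fix a b show "u a \<bullet> u b = (if a = b then 1 else 0)"
    proof (cases "a = b")
      case True then show ?thesis using B(2) uB by (simp add: norm_eq_1[symmetric])
    next
      case False
      then have "u a \<noteq> u b" using u by (auto simp: bij_betw_def inj_on_def)
      then show ?thesis using False B(1) uB by (auto simp: pairwise_def orthogonal_def)
    qed
  qed (rule ev)
  then show ?thesis using that by blast
qed

section \<open>Ordered eigenvalues\<close>

lemma sorted_nth_le:
  fixes xs :: "'a::linorder list"
  assumes "sorted xs" and "j < length (filter (\<lambda>x. x \<le> t) xs)"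
  shows "xs ! j \<le> t"
proof (rule ccontr)
  assume *: "\<not> xs ! j \<le> t"
  have "{i. i < length xs \<and> xs ! i \<le> t} \<subseteq> {..<j}"
  proof
    fix i assume i: "i \<in> {i. i < length xs \<and> xs ! i \<le> t}"
    show "i \<in> {..<j}"
    proof (rule ccontr)
      assume "i \<notin> {..<j}"
      then have "xs ! j \<le> xs ! i"
        using i by (intro sorted_nth_mono[OF assms(1)]) simp_all
      also have "xs ! i \<le> t" using i by simp
      finally show False using * by contradiction
    qed
  qed
  then have "length (filter (\<lambda>x. x \<le> t) xs) \<le> card {..<j}"
    unfolding length_filter_conv_card by (intro card_mono) auto
  then show False using assms(2) by simp
qed

lemma sorted_le_nth:
  fixes xs :: "'a::linorder list"
  assumes "sorted xs" and "j < length xs" and "length (filter (\<lambda>x. x < t) xs) \<le> j"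
  shows "t \<le> xs ! j"
proof (rule ccontr)
  assume *: "\<not> t \<le> xs ! j"
  have "{..j} \<subseteq> {i. i < length xs \<and> xs ! i < t}"
  proof
    fix i assume i: "i \<in> {..j}"
    then have "xs ! i \<le> xs ! j"
      using assms(2) by (intro sorted_nth_mono[OF assms(1)]) simp_all
    then show "i \<in> {i. i < length xs \<and> xs ! i < t}"
      using i * assms(2) by auto
  qed
  then have "card {..j} \<le> length (filter (\<lambda>x. x < t) xs)"
    unfolding length_filter_conv_card by (intro card_mono) auto
  then show False using assms(3) by simp
qed

lemma subspace_eigenspace: "subspace (eigenspace_on C A c)"
proof (rule subspaceI)
  fix x y assume "x \<in> eigenspace_on C A c" "y \<in> eigenspace_on C A c"
  then show "x + y \<in> eigenspace_on C A c"
    by (simp add: eigenspace_on_def distrib_left sum.distrib)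
next
  fix a x assume x: "x \<in> eigenspace_on C A c"
  have "(\<Sum>j\<in>C. A $ i $ j * (a * x $ j)) = a * (\<Sum>j\<in>C. A $ i $ j * x $ j)" for i
    unfolding sum_distrib_left by (rule sum.cong) auto
  with x show "a *\<^sub>R x \<in> eigenspace_on C A c"
    by (simp add: eigenspace_on_def mult.left_commute)
qed (simp add: eigenspace_on_def)

text \<open>
  With linear independence this bounds the number of eigenvalues, so that the sum defining
  \<^const>\<open>eigvals_on\<close> ranges over a finite set and is not the default value \<open>0\<close>.
\<close>

lemma eigenspaces_orthogonal:
  fixes A :: "real^'n^'n"
  assumes A: "transpose A = A" and v: "v \<in> eigenspace_on C A c" and w: "w \<in> eigenspace_on C A c'"
    and "c \<noteq> c'"
  shows "v \<bullet> w = 0"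
proof -
  have sym: "A $ i $ j = A $ j $ i" for i j
    using A by (metis transpose_def vec_lambda_beta)
  have vw: "v \<bullet> w = (\<Sum>i\<in>C. v $ i * w $ i)"
    unfolding inner_vec_def using v
    by (intro sum.mono_neutral_cong_right) (auto simp: eigenspace_on_def)
  have "c * (v \<bullet> w) = (\<Sum>i\<in>C. (\<Sum>j\<in>C. A $ i $ j * v $ j) * w $ i)"
    unfolding vw sum_distrib_left using v by (intro sum.cong) (auto simp: eigenspace_on_def)
  also have "\<dots> = (\<Sum>j\<in>C. \<Sum>i\<in>C. A $ i $ j * v $ j * w $ i)"
    by (simp add: sum_distrib_right) (rule sum.swap)
  also have "\<dots> = (\<Sum>j\<in>C. v $ j * (\<Sum>i\<in>C. A $ j $ i * w $ i))"
    by (simp add: sum_distrib_left sym mult_ac)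
  also have "\<dots> = c' * (v \<bullet> w)"
    unfolding vw sum_distrib_left using w by (intro sum.cong) (auto simp: eigenspace_on_def sum_distrib_left[symmetric])
  finally show ?thesis using \<open>c \<noteq> c'\<close> by simp
qed

lemma finite_eigenvalues:
  fixes A :: "real^'n^'n"
  assumes A: "transpose A = A"
  shows "finite {c. eigenspace_on C A c \<noteq> {0}}" (is "finite ?E")
proof -
  have "\<forall>c\<in>?E. \<exists>v. v \<in> eigenspace_on C A c \<and> v \<noteq> 0"
    using subspace_0[OF subspace_eigenspace, of C A] by blast
  then obtain v where v: "\<And>c. c \<in> ?E \<Longrightarrow> v c \<in> eigenspace_on C A c \<and> v c \<noteq> 0"
    by metis
  have orth: "v c \<bullet> v c' = 0" if "c \<in> ?E" "c' \<in> ?E" "c \<noteq> c'" for c c'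
    using eigenspaces_orthogonal[OF A] v that by blast
  have "independent (v ` ?E)"
  proof (rule pairwise_orthogonal_independent)
    show "pairwise orthogonal (v ` ?E)"
      using orth by (auto simp: pairwise_def orthogonal_def)
    show "0 \<notin> v ` ?E"
    proof
      assume "0 \<in> v ` ?E"
      then obtain c where "c \<in> ?E" "0 = v c" by (rule imageE)
      then show False using v[of c] by simp
    qed
  qed
  then have "finite (v ` ?E)"
    by (rule independent_imp_finite)
  moreover have "inj_on v ?E"
  proof (rule inj_onI, rule ccontr)
    fix c c' assume c: "c \<in> ?E" "c' \<in> ?E" "v c = v c'" "c \<noteq> c'"
    then have "v c \<bullet> v c = 0"
      using orth[of c c'] by simp
    then show False
      using v[OF c(1)] by simp
  qed
  ultimately show ?thesis by (rule finite_imageD)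
qed

lemma mset_eigvals_on: "mset (eigvals_on C A) =
    (\<Sum>c | eigenspace_on C A c \<noteq> {0}. replicate_mset (dim (eigenspace_on C A c)) c)"
  by (simp add: eigvals_on_def)

lemma count_eigvals_on:
  assumes "finite {c. eigenspace_on C A c \<noteq> {0}}"
  shows "count (mset (eigvals_on C A)) c = dim (eigenspace_on C A c)"
proof -
  have "count (mset (eigvals_on C A)) c
      = (\<Sum>b | eigenspace_on C A b \<noteq> {0}. if c = b then dim (eigenspace_on C A b) else 0)"
    by (simp add: mset_eigvals_on count_sum eq_commute[of c])
  also have "\<dots> = dim (eigenspace_on C A c)"
    using assms by (simp add: sum.delta')
  finally show ?thesis .
qed

lemma sorted_eigvals_on: "sorted (eigvals_on C A)"
  by (simp add: eigvals_on_def)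

text \<open>
  Used for the Laplacian of a single component, where a few explicit eigenvectors are known instead of
  an eigenbasis: eigenvectors with eigenvalue at most \<open>t\<close> that span \<open>j\<close> dimensions suffice.
\<close>

lemma eigval_on_le:
  fixes A :: "real^'n^'n"
  assumes A: "transpose A = A" and "finite S" and S: "\<And>c. c \<in> S \<Longrightarrow> c \<le> t"
    and j: "1 \<le> j" "j \<le> (\<Sum>c\<in>S. dim (eigenspace_on C A c))"
  shows "eigval_on C j A \<le> t"
proof -
  let ?M = "mset (eigvals_on C A)"
  have "(\<Sum>c\<in>S. dim (eigenspace_on C A c)) = (\<Sum>c\<in>S. count (filter_mset (\<lambda>x. x \<le> t) ?M) c)"
    using S by (intro sum.cong) (auto simp: count_eigvals_on[OF finite_eigenvalues[OF A]])
  also have "\<dots> \<le> (\<Sum>c\<in>S \<union> set_mset (filter_mset (\<lambda>x. x \<le> t) ?M). count (filter_mset (\<lambda>x. x \<le> t) ?M) c)"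
    using \<open>finite S\<close> by (intro sum_mono2) auto
  also have "\<dots> = size (filter_mset (\<lambda>x. x \<le> t) ?M)"
    unfolding size_multiset_overloaded_eq using \<open>finite S\<close>
    by (intro sum.mono_neutral_right) (auto simp: count_eq_zero_iff simp flip: mset_filter)
  also have "\<dots> = length (filter (\<lambda>x. x \<le> t) (eigvals_on C A))"
    by (simp flip: mset_filter)
  finally have "j - 1 < length (filter (\<lambda>x. x \<le> t) (eigvals_on C A))"
    using j by linarith
  then show ?thesis
    unfolding eigval_on_def by (rule sorted_nth_le[OF sorted_eigvals_on])
qed

context eigenbasis
begin

text \<open>
  This ties the ordered eigenvalues of the definition to the eigenvalues of an arbitrary
  orthonormal eigenbasis, so that the latter can be chosen as convenient.
\<close>

lemma mset_eigvals: "mset (eigvals_on UNIV A) = image_mset ev (mset_set UNIV)"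
proof (rule multiset_eqI)
  fix c
  have "{c. eigenspace_on UNIV A c \<noteq> {0}} \<subseteq> range ev"
  proof
    fix c assume "c \<in> {c. eigenspace_on UNIV A c \<noteq> {0}}"
    then have "span (u ` {k. ev k = c}) \<noteq> {0}"
      by (simp only: eigenspace_eq_span mem_Collect_eq not_False_eq_True)
    then have "{k. ev k = c} \<noteq> {}"
      by (rule contrapos_nn) (simp only: image_empty span_empty)
    then show "c \<in> range ev" by auto
  qed
  then have "finite {c. eigenspace_on UNIV A c \<noteq> {0}}"
    by (rule finite_subset) simp
  then have "count (mset (eigvals_on UNIV A)) c = card {k. ev k = c}"
    by (simp only: count_eigvals_on dim_eigenspace)
  also have "\<dots> = count (image_mset ev (mset_set UNIV)) c"
    by (simp add: count_image_mset' eq_commute[of c])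
  finally show "count (mset (eigvals_on UNIV A)) c = count (image_mset ev (mset_set UNIV)) c" .
qed

lemma length_eigvals: "length (eigvals_on UNIV A) = CARD('n)"
  using arg_cong[OF mset_eigvals, of size] by simp

lemma length_filter_eigvals: "length (filter P (eigvals_on UNIV A)) = card {k. P (ev k)}"
proof -
  have "length (filter P (eigvals_on UNIV A)) = size (filter_mset P (image_mset ev (mset_set UNIV)))"
    using arg_cong[OF mset_eigvals, of "\<lambda>M. size (filter_mset P M)"] by (simp flip: mset_filter)
  then show ?thesis
    by (simp add: filter_mset_image_mset)
qed

lemma eigval_leI: "1 \<le> j \<Longrightarrow> j \<le> card {k. ev k \<le> t} \<Longrightarrow> eigval j A \<le> t"
  unfolding eigval_on_def
  by (rule sorted_nth_le[OF sorted_eigvals_on]) (simp add: length_filter_eigvals)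

lemma eigval_geI:
  "1 \<le> j \<Longrightarrow> j \<le> CARD('n) \<Longrightarrow> card {k. ev k < t} < j \<Longrightarrow> t \<le> eigval j A"
  unfolding eigval_on_def
  by (rule sorted_le_nth[OF sorted_eigvals_on]) (auto simp: length_filter_eigvals length_eigvals)

lemma card_less_eigval:
  assumes "1 \<le> j" shows "card {k. ev k < eigval j A} < j"
proof (rule ccontr)
  assume *: "\<not> card {k. ev k < eigval j A} < j"
  then have ne: "{k. ev k < eigval j A} \<noteq> {}"
  proof -
    have "card {k. ev k < eigval j A} \<noteq> 0"
      using * assms by linarith
    then show ?thesis
      by (rule contrapos_nn) simp
  qed
  define t where "t = Max (ev ` {k. ev k < eigval j A})"
  have t: "t < eigval j A"
    unfolding t_def using ne by (subst Max_less_iff) auto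
  have "card {k. ev k < eigval j A} \<le> card {k. ev k \<le> t}"
    by (intro card_mono) (auto simp: t_def)
  then have "eigval j A \<le> t"
    using * assms by (intro eigval_leI) auto
  then show False using t by simp
qed

lemma card_le_eigval:
  assumes "1 \<le> j" "j \<le> CARD('n)" shows "j \<le> card {k. ev k \<le> eigval j A}"
proof (rule ccontr)
  assume *: "\<not> j \<le> card {k. ev k \<le> eigval j A}"
  then have ne: "{k. \<not> ev k \<le> eigval j A} \<noteq> {}"
  proof -
    have "{k. \<not> ev k \<le> eigval j A} \<noteq> {}" if "card {k. ev k \<le> eigval j A} < CARD('n)"
    proof
      assume "{k. \<not> ev k \<le> eigval j A} = {}"
      then have "{k. ev k \<le> eigval j A} = UNIV" by auto
      with that show False by simp
    qed
    with * assms(2) show ?thesis by simp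
  qed
  define t where "t = Min (ev ` {k. \<not> ev k \<le> eigval j A})"
  have t: "eigval j A < t"
    unfolding t_def using ne by (subst Min_gr_iff) auto
  have "t \<le> ev k" if "\<not> ev k \<le> eigval j A" for k
    unfolding t_def using that by (intro Min_le) auto
  then have "ev k \<le> eigval j A" if "ev k < t" for k
    using that leD by blast
  then have "card {k. ev k < t} \<le> card {k. ev k \<le> eigval j A}"
    by (intro card_mono) auto
  then have "t \<le> eigval j A"
    using * assms by (intro eigval_geI) auto
  then show False using t by simp
qed

end

section \<open>Graph Laplacians\<close>

lemma endpoints_edge_between: "i \<noteq> j \<Longrightarrow> endpoints (edge_between i j) = {i, j}"
  by (simp add: edge_between_def Edge_inverse)

lemma edge_between_commute: "edge_between i j = edge_between j i"
  by (simp add: edge_between_def insert_commute)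

lemma edge_cases:
  obtains i j where "i \<noteq> j" "e = edge_between i j"
proof -
  have "card (endpoints e) = 2"
    using endpoints[of e] by simp
  then obtain i j where "endpoints e = {i, j}" "i \<noteq> j"
    by (auto simp: card_2_iff)
  then show ?thesis
    using that[of i j] by (metis edge_between_def endpoints_inverse)
qed

lemma edge_between_eq_iff:
  assumes "i \<noteq> j" "k \<noteq> l"
  shows "edge_between i j = edge_between k l \<longleftrightarrow> (i = k \<and> j = l) \<or> (i = l \<and> j = k)"
  using assms by (simp flip: endpoints_inject add: endpoints_edge_between doubleton_eq_iff)

lemma edge_between_in_pairs: "i \<noteq> j \<Longrightarrow> edge_between i j \<in> pairs_in C \<longleftrightarrow> i \<in> C \<and> j \<in> C"
  by (simp add: pairs_in_def endpoints_edge_between)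

lemma adjacency_nth: "adjacency x $ i $ j = (if i = j then 0 else x $ edge_between i j)"
  by (simp add: adjacency_def)

lemma adjacency_commute: "adjacency x $ i $ j = adjacency x $ j $ i"
  by (simp add: adjacency_nth edge_between_commute)

lemma adjacency_abs: "adjacency \<bar>x\<bar> $ i $ j = \<bar>adjacency x $ i $ j\<bar>"
  by (simp add: adjacency_nth abs_vec_def)

lemma laplacian_mult:
  "(laplacian x *v v) $ i = (\<Sum>j\<in>UNIV. adjacency x $ i $ j * (v $ i - v $ j))"
proof -
  have "(laplacian x *v v) $ i
      = (\<Sum>j\<in>UNIV. (if i = j then (adjacency x *v 1) $ i else 0) * v $ j)
        - (\<Sum>j\<in>UNIV. adjacency x $ i $ j * v $ j)"
    by (simp add: laplacian_def matrix_vector_mult_def left_diff_distrib sum_subtractf)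
  also have "(\<Sum>j\<in>UNIV. (if i = j then (adjacency x *v 1) $ i else 0) * v $ j)
      = (\<Sum>j\<in>UNIV. adjacency x $ i $ j * v $ i)"
    by (simp add: if_distrib[of "\<lambda>y. y * _"] matrix_vector_mult_def sum_distrib_right cong: if_cong)
  finally show ?thesis
    by (simp add: right_diff_distrib sum_subtractf)
qed

lemma laplacian_symmetric: "transpose (laplacian x) = laplacian x"
  by (simp add: vec_eq_iff transpose_def laplacian_def adjacency_commute)

lemma laplacian_diff: "laplacian (x - y) = laplacian x - laplacian y"
proof -
  have "adjacency (x - y) $ i $ j = adjacency x $ i $ j - adjacency y $ i $ j" for i j
    by (simp add: adjacency_nth)
  then have "laplacian (x - y) *v v = (laplacian x - laplacian y) *v v" for v
    by (simp add: vec_eq_iff matrix_vector_mult_diff_rdistrib laplacian_mult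
        left_diff_distrib sum_subtractf)
  then show ?thesis by (simp add: matrix_eq)
qed

lemma laplacian_quadratic_form:
  "v \<bullet> (laplacian x *v v) = 1 / 2 * (\<Sum>i\<in>UNIV. \<Sum>j\<in>UNIV. adjacency x $ i $ j * (v $ i - v $ j)\<^sup>2)"
proof -
  let ?a = "\<lambda>i j. adjacency x $ i $ j"
  have q: "v \<bullet> (laplacian x *v v) = (\<Sum>i\<in>UNIV. \<Sum>j\<in>UNIV. ?a i j * (v $ i - v $ j) * v $ i)"
    by (simp add: inner_vec_def laplacian_mult sum_distrib_left mult_ac)
  also have "\<dots> = (\<Sum>i\<in>UNIV. \<Sum>j\<in>UNIV. ?a i j * (v $ j - v $ i) * v $ j)"
    by (subst sum.swap) (simp add: adjacency_commute)
  finally have "2 * (v \<bullet> (laplacian x *v v)) =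
      (\<Sum>i\<in>UNIV. \<Sum>j\<in>UNIV. ?a i j * (v $ i - v $ j) * v $ i)
      + (\<Sum>i\<in>UNIV. \<Sum>j\<in>UNIV. ?a i j * (v $ j - v $ i) * v $ j)"
    using q by simp
  also have "\<dots> = (\<Sum>i\<in>UNIV. \<Sum>j\<in>UNIV. ?a i j * (v $ i - v $ j)\<^sup>2)"
    unfolding sum.distrib[symmetric]
    by (intro sum.cong refl) (simp add: power2_eq_square algebra_simps)
  finally show ?thesis by simp
qed

lemma laplacian_psd: "0 \<le> v \<bullet> (laplacian \<bar>x\<bar> *v v)"
  by (simp add: laplacian_quadratic_form adjacency_abs sum_nonneg)

definition connected_in :: "real^('n::card2 edge) \<Rightarrow> ('n::card2 \<times> 'n) set" where
  "connected_in x = {(i, j). adjacency x $ i $ j \<noteq> 0}\<^sup>*"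

lemma components_of_eq: "components_of x = UNIV // connected_in x"
  by (simp add: components_of_def connected_in_def)

lemma equiv_connected_in: "equiv UNIV (connected_in x)"
proof -
  have "sym {(i, j). adjacency x $ i $ j \<noteq> 0}"
    by (auto simp: sym_def adjacency_commute)
  then show ?thesis
    unfolding connected_in_def by (intro equivI refl_rtrancl trans_rtrancl sym_rtrancl) simp_all
qed

lemma connected_in_refl [simp]: "(i, i) \<in> connected_in x"
  by (simp add: connected_in_def)

lemma connected_in_sym: "(i, j) \<in> connected_in x \<Longrightarrow> (j, i) \<in> connected_in x"
  using equiv_connected_in[of x] by (meson equivE symE)

lemma connected_in_trans:
  "(i, j) \<in> connected_in x \<Longrightarrow> (j, k) \<in> connected_in x \<Longrightarrow> (i, k) \<in> connected_in x"
  unfolding connected_in_def by (rule rtrancl_trans)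

lemma mem_component_iff:
  assumes "C \<in> components_of x" "i \<in> C"
  shows "j \<in> C \<longleftrightarrow> (i, j) \<in> connected_in x"
proof -
  obtain k where k: "C = connected_in x `` {k}"
    using assms(1) unfolding components_of_eq by (rule quotientE)
  show ?thesis
    using assms(2) connected_in_sym connected_in_trans unfolding k by fast
qed

lemma component_in_components: "connected_in x `` {i} \<in> components_of x"
  by (simp add: components_of_eq quotientI)

lemma edge_in_same_component:
  assumes "i \<noteq> j"
  shows "edge_between i j \<in> same_component x \<longleftrightarrow> (i, j) \<in> connected_in x"
proof
  assume "edge_between i j \<in> same_component x"
  then obtain C where "C \<in> components_of x" "i \<in> C" "j \<in> C"
    using assms by (auto simp: same_component_def edge_between_in_pairs)
  then show "(i, j) \<in> connected_in x"
    using mem_component_iff by blast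
next
  assume "(i, j) \<in> connected_in x"
  then have "edge_between i j \<in> pairs_in (connected_in x `` {i})"
    using assms by (simp add: edge_between_in_pairs)
  then show "edge_between i j \<in> same_component x"
    unfolding same_component_def using component_in_components by blast
qed

lemma card_component_le: "C \<in> components_of x \<Longrightarrow> card C \<le> max_component x"
  unfolding max_component_def by (intro Max_ge) auto

lemma max_component_pos: "1 \<le> max_component x"
proof -
  have "connected_in x `` {undefined} \<noteq> {}"
    by (auto intro: connected_in_refl)
  then have "1 \<le> card (connected_in x `` {undefined})"
    by (simp add: Suc_le_eq card_gt_0_iff)
  then show ?thesis
    using card_component_le[OF component_in_components] by (rule order_trans)
qed

lemma num_components_pos: "1 \<le> num_components x"
proof -
  have "components_of x \<noteq> {}"
    using component_in_components by blast
  then show ?thesis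
    by (simp add: num_components_def Suc_le_eq card_gt_0_iff)
qed

definition indicator_vec :: "'n set \<Rightarrow> real^'n" where
  "indicator_vec C = (\<chi> i. if i \<in> C then 1 else 0)"

lemma inner_indicator_vec: "v \<bullet> indicator_vec C = (\<Sum>i\<in>C. v $ i)"
proof -
  have "v \<bullet> indicator_vec C = (\<Sum>i\<in>UNIV. if i \<in> C then v $ i else 0)"
    by (simp add: inner_vec_def indicator_vec_def if_distrib cong: if_cong)
  then show ?thesis by (simp add: sum.If_cases)
qed

lemma indicator_vec_inner_self: "indicator_vec C \<bullet> indicator_vec C = real (card C)"
  by (simp add: inner_indicator_vec) (simp add: indicator_vec_def)

text \<open>
  The kernel of the Laplacian of the target, see \<open>laplacian_kernel\<close>.
\<close>

definition blockwise_constant :: "real^('n::card2 edge) \<Rightarrow> (real^('n::card2)) set" where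
  "blockwise_constant x = {v. \<forall>i j. (i, j) \<in> connected_in x \<longrightarrow> v $ i = v $ j}"

lemma indicator_vec_blockwise_constant:
  "C \<in> components_of x \<Longrightarrow> indicator_vec C \<in> blockwise_constant x"
  unfolding blockwise_constant_def indicator_vec_def
  using mem_component_iff connected_in_sym by fastforce

text \<open>
  The indicators of the components form an orthogonal basis.
\<close>

lemma dim_blockwise_constant: "dim (blockwise_constant x) = num_components x"
proof -
  let ?B = "indicator_vec ` components_of x"
  have ne: "C \<noteq> {}" if C: "C \<in> components_of x" for C
    using C unfolding components_of_eq by (metis equiv_connected_in in_quotient_imp_non_empty)
  have orth: "indicator_vec C \<bullet> indicator_vec D = 0"
    if CD: "C \<in> components_of x" "D \<in> components_of x" "C \<noteq> D" for C D
  proof -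
    have "C \<inter> D = {}"
      using CD unfolding components_of_eq by (metis equiv_connected_in quotient_disj)
    then show ?thesis
      by (simp add: inner_indicator_vec) (auto simp: indicator_vec_def intro!: sum.neutral)
  qed
  have nz: "indicator_vec C \<noteq> 0" if "C \<in> components_of x" for C
  proof
    assume "indicator_vec C = 0"
    then have "card C = 0"
      using indicator_vec_inner_self[of C] by simp
    then show False using ne[OF that] by simp
  qed
  have "independent ?B"
  proof (rule pairwise_orthogonal_independent)
    show "pairwise orthogonal ?B"
      using orth unfolding pairwise_def orthogonal_def by blast
    show "0 \<notin> ?B" using nz by force
  qed
  moreover have "inj_on indicator_vec (components_of x)"
    by (rule inj_onI) (metis orth nz inner_eq_zero_iff)
  then have "card ?B = num_components x"
    by (simp add: card_image num_components_def)
  moreover have "?B \<subseteq> blockwise_constant x"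
    using indicator_vec_blockwise_constant by blast
  moreover have "blockwise_constant x \<subseteq> span ?B"
  proof
    fix v assume v: "v \<in> blockwise_constant x"
    let ?r = "\<lambda>C. SOME i. i \<in> C"
    have "v = (\<Sum>C\<in>components_of x. v $ (?r C) *\<^sub>R indicator_vec C)"
    proof (rule vec_eq_iff[THEN iffD2], rule allI)
      fix i
      let ?C = "connected_in x `` {i}"
      have mem: "i \<in> C \<longleftrightarrow> C = ?C" if C: "C \<in> components_of x" for C
      proof
        assume "i \<in> C" then show "C = ?C" using mem_component_iff[OF C] by blast
      qed simp
      have "?r ?C \<in> ?C" by (rule someI[of _ i]) simp
      then have "v $ i = v $ (?r ?C)" using v by (auto simp: blockwise_constant_def)
      have "(\<Sum>C\<in>components_of x. v $ (?r C) *\<^sub>R indicator_vec C) $ i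
          = (\<Sum>C\<in>components_of x. if C = ?C then v $ (?r C) else 0)"
        unfolding sum_component by (intro sum.cong) (auto simp: indicator_vec_def mem)
      also have "\<dots> = v $ (?r ?C)"
        by (simp add: component_in_components)
      finally show "v $ i = (\<Sum>C\<in>components_of x. v $ (?r C) *\<^sub>R indicator_vec C) $ i"
        using \<open>v $ i = v $ (?r ?C)\<close> by simp
    qed
    moreover have "(\<Sum>C\<in>components_of x. v $ (?r C) *\<^sub>R indicator_vec C) \<in> span ?B"
      by (intro span_sum span_scale span_base) simp
    ultimately show "v \<in> span ?B" by simp
  qed
  ultimately show ?thesis
    by (metis dim_unique)
qed

lemma restr_eq_0_iff: "restr S x = 0 \<longleftrightarrow> (\<forall>e\<in>S. x $ e = 0)"
  by (auto simp: restr_def vec_eq_iff)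

lemma supported_on_same_component: "restr (- same_component x) x = 0"
  unfolding restr_eq_0_iff
proof (rule ballI, rule ccontr)
  fix e assume e: "e \<in> - same_component x" "x $ e \<noteq> 0"
  obtain i j where ij: "i \<noteq> j" "e = edge_between i j"
    by (rule edge_cases)
  then have "adjacency x $ i $ j \<noteq> 0"
    using e by (simp add: adjacency_nth)
  then have "(i, j) \<in> connected_in x"
    unfolding connected_in_def by blast
  then show False
    using e ij by (simp add: edge_in_same_component)
qed

lemma adjacency_zero_off_components:
  assumes "restr (- same_component x) b = 0" and "(i, j) \<notin> connected_in x"
  shows "adjacency b $ i $ j = 0"
proof (cases "i = j")
  case False
  then have "edge_between i j \<in> - same_component x"
    using assms(2) by (simp add: edge_in_same_component)
  then show ?thesis
    using assms(1) by (simp add: restr_eq_0_iff adjacency_nth)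
qed (simp add: adjacency_nth)

text \<open>
  Stated for every vector with the block support of \<open>x\<close>, because the second step needs it for
  solutions of the Lasso block oracle problem, whose own components may be finer than those of the target.
\<close>

lemma laplacian_blockwise_constant:
  assumes b: "restr (- same_component x) b = 0" and v: "v \<in> blockwise_constant x"
  shows "laplacian \<bar>b\<bar> *v v = 0"
  unfolding vec_eq_iff laplacian_mult
proof (intro allI)
  fix i
  have "adjacency \<bar>b\<bar> $ i $ j * (v $ i - v $ j) = 0" for j
  proof (cases "(i, j) \<in> connected_in x")
    case True
    then show ?thesis using v by (simp add: blockwise_constant_def)
  qed (simp add: adjacency_abs adjacency_zero_off_components[OF b])
  then show "(\<Sum>j\<in>UNIV. adjacency \<bar>b\<bar> $ i $ j * (v $ i - v $ j)) = 0 $ i"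
    by (simp only: sum.neutral_const zero_index)
qed

text \<open>
  In the quadratic form all summands are nonnegative, so they vanish one by one; equality of the
  entries then propagates along paths.
\<close>

lemma laplacian_kernel:
  assumes "laplacian \<bar>x\<bar> *v v = 0"
  shows "v \<in> blockwise_constant x"
proof -
  have "(\<Sum>i\<in>UNIV. \<Sum>j\<in>UNIV. \<bar>adjacency x $ i $ j\<bar> * (v $ i - v $ j)\<^sup>2) = 0"
    using assms laplacian_quadratic_form[of v "\<bar>x\<bar>"] by (simp add: adjacency_abs)
  then have z: "\<bar>adjacency x $ i $ j\<bar> * (v $ i - v $ j)\<^sup>2 = 0" for i j
    by (simp add: sum_nonneg_eq_0_iff sum_nonneg)
  have "v $ i = v $ j" if "(i, j) \<in> connected_in x" for i j
    using that unfolding connected_in_def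
  proof (induction rule: rtrancl_induct)
    case (step k l)
    then show ?case using z[of k l] by simp
  qed simp
  then show ?thesis by (auto simp: blockwise_constant_def)
qed

text \<open>
  Each unordered pair arises from exactly two ordered ones.
\<close>

lemma sum_same_component:
  "2 * (\<Sum>e\<in>same_component x. f e)
    = (\<Sum>(i, j)\<in>{(i, j)\<in>connected_in x. i \<noteq> j}. f (edge_between i j) :: real)"
proof -
  let ?P = "{(i, j)\<in>connected_in x. i \<noteq> j}"
  let ?e = "\<lambda>(i, j). edge_between i j"
  have "(\<Sum>p\<in>?P. f (?e p)) = (\<Sum>e\<in>same_component x. \<Sum>p\<in>{p \<in> ?P. ?e p = e}. f (?e p))"
    by (rule sum.group[symmetric]) (auto simp: edge_in_same_component)
  also have "\<dots> = (\<Sum>e\<in>same_component x. 2 * f e)"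
  proof (rule sum.cong[OF refl])
    fix e assume e: "e \<in> same_component x"
    obtain i j where ij: "i \<noteq> j" "e = edge_between i j"
      by (rule edge_cases)
    then have c: "(i, j) \<in> connected_in x"
      using e by (simp add: edge_in_same_component)
    have "{p \<in> ?P. ?e p = e} = {(i, j), (j, i)}"
      using c connected_in_sym[OF c] ij by (auto simp: edge_between_eq_iff)
    then have "(\<Sum>p\<in>{p \<in> ?P. ?e p = e}. f (?e p)) = (\<Sum>p\<in>{(i, j), (j, i)}. f (?e p))"
      by (rule arg_cong)
    also have "\<dots> = 2 * f e"
      using ij by (simp add: edge_between_commute[of j i])
    finally show "(\<Sum>p\<in>{p \<in> ?P. ?e p = e}. f (?e p)) = 2 * f e" .
  qed
  finally show ?thesis
    by (simp add: sum_distrib_left case_prod_beta)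
qed

section \<open>Convex minimization with a weighted absolute-value penalty\<close>

lemma gderiv_gradient:
  fixes l :: "'a::euclidean_space \<Rightarrow> real"
  assumes "l differentiable (at x)"
  shows "GDERIV l x :> gradient l x"
proof -
  obtain f where f: "(l has_derivative f) (at x)"
    using assms by (auto simp: differentiable_def)
  interpret f: bounded_linear f
    using f by (rule has_derivative_bounded_linear)
  define D where "D = (\<Sum>b\<in>Basis. f b *\<^sub>R b)"
  have "f h = h \<bullet> D" for h
  proof -
    have "f h = f (\<Sum>b\<in>Basis. (h \<bullet> b) *\<^sub>R b)"
      by (simp add: euclidean_representation)
    also have "\<dots> = (\<Sum>b\<in>Basis. (h \<bullet> b) * f b)"
      by (simp add: f.sum f.scaleR)
    finally show ?thesis
      by (simp add: D_def inner_sum_right mult.commute)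
  qed
  then have "f = (\<lambda>h. h \<bullet> D)" by (rule ext)
  with f have D: "GDERIV l x :> D"
    by (simp add: gderiv_def)
  show ?thesis
    unfolding gradient_def
  proof (rule theI[where a = D])
    fix D' assume "GDERIV l x :> D'"
    with D have "(\<lambda>h. h \<bullet> D') = (\<lambda>h. h \<bullet> D)"
      unfolding gderiv_def by (rule has_derivative_unique[rotated])
    then have "(D' - D) \<bullet> D' = (D' - D) \<bullet> D" by meson
    then have "(D' - D) \<bullet> (D' - D) = 0" by (simp add: inner_diff_right)
    then show "D' = D" by simp
  qed (rule D)
qed

lemma directional_derivative_gradient:
  fixes l :: "'a::euclidean_space \<Rightarrow> real"
  assumes "l differentiable (at x)"
  shows "((\<lambda>t. (l (x + t *\<^sub>R u) - l x) / t) \<longlongrightarrow> gradient l x \<bullet> u) (at_right 0)"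
proof -
  have "(l has_derivative (\<lambda>h. h \<bullet> gradient l x)) (at (x + 0 *\<^sub>R u))"
    using gderiv_gradient[OF assms] by (simp add: gderiv_def)
  moreover have "((\<lambda>t. x + t *\<^sub>R u) has_derivative (\<lambda>t. t *\<^sub>R u)) (at 0)"
    by (auto intro!: derivative_eq_intros)
  ultimately have "((\<lambda>t. l (x + t *\<^sub>R u)) has_derivative (\<lambda>t. t *\<^sub>R u \<bullet> gradient l x)) (at 0)"
    using diff_chain_at[of "\<lambda>t. x + t *\<^sub>R u" "\<lambda>t. t *\<^sub>R u" 0 l "\<lambda>h. h \<bullet> gradient l x"]
    by (simp add: o_def)
  then have "((\<lambda>t. l (x + t *\<^sub>R u)) has_real_derivative gradient l x \<bullet> u) (at 0)"
    by (simp add: has_field_derivative_def inner_commute mult_commute_abs)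
  then have "((\<lambda>t. (l (x + t *\<^sub>R u) - l x) / t) \<longlongrightarrow> gradient l x \<bullet> u) (at 0)"
    by (simp add: has_field_derivative_iff)
  then show ?thesis
    by (rule tendsto_mono[rotated]) (simp add: at_le)
qed

lemma eventually_at_right_unit: "\<forall>\<^sub>F t in at_right 0. 0 < t \<and> t < (1::real)"
  unfolding eventually_at_right_field by (intro exI[of _ 1]) auto

lemma convex_ge_linearization:
  fixes l :: "'a::euclidean_space \<Rightarrow> real"
  assumes "convex_on UNIV l" and "l differentiable (at x)"
  shows "l x + gradient l x \<bullet> (y - x) \<le> l y"
proof -
  have "\<forall>\<^sub>F t in at_right 0. (l (x + t *\<^sub>R (y - x)) - l x) / t \<le> l y - l x"
    using eventually_at_right_unit
  proof (rule eventually_mono)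
    fix t :: real assume t: "0 < t \<and> t < 1"
    have "x + t *\<^sub>R (y - x) = (1 - t) *\<^sub>R x + t *\<^sub>R y"
      by (simp add: algebra_simps)
    then have "l (x + t *\<^sub>R (y - x)) \<le> (1 - t) * l x + t * l y"
      using convex_onD[OF assms(1), of t x y] t by simp
    then have "l (x + t *\<^sub>R (y - x)) - l x \<le> (l y - l x) * t"
      by (simp add: algebra_simps)
    then show "(l (x + t *\<^sub>R (y - x)) - l x) / t \<le> l y - l x"
      using t by (simp add: divide_le_eq)
  qed
  then have "gradient l x \<bullet> (y - x) \<le> l y - l x"
    by (rule tendsto_upperbound[OF directional_derivative_gradient[OF assms(2)]]) simp
  then show ?thesis by simp
qed

lemma weighted_l1_segment:
  assumes w: "0 \<le> w" and t: "0 \<le> t" "t \<le> 1"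
  shows "weighted_l1 S w (x + t *\<^sub>R u) - weighted_l1 S w x
           \<le> t * (weighted_l1 S w (x + u) - weighted_l1 S w x)"
proof -
  have e: "w $ e * \<bar>(x + t *\<^sub>R u) $ e\<bar> - w $ e * \<bar>x $ e\<bar>
      \<le> t * (w $ e * \<bar>(x + u) $ e\<bar> - w $ e * \<bar>x $ e\<bar>)" for e
  proof -
    have "(x + t *\<^sub>R u) $ e = (1 - t) * x $ e + t * ((x + u) $ e)"
      by (simp add: algebra_simps)
    also have "\<bar>\<dots>\<bar> \<le> (1 - t) * \<bar>x $ e\<bar> + t * \<bar>(x + u) $ e\<bar>"
      using t by (intro order_trans[OF abs_triangle_ineq]) (simp add: abs_mult)
    finally have "\<bar>(x + t *\<^sub>R u) $ e\<bar> - \<bar>x $ e\<bar> \<le> t * (\<bar>(x + u) $ e\<bar> - \<bar>x $ e\<bar>)"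
      by (simp add: algebra_simps)
    then have "w $ e * (\<bar>(x + t *\<^sub>R u) $ e\<bar> - \<bar>x $ e\<bar>) \<le> w $ e * (t * (\<bar>(x + u) $ e\<bar> - \<bar>x $ e\<bar>))"
      using w by (intro mult_left_mono) (auto simp: less_eq_vec_def)
    then show ?thesis by (simp add: right_diff_distrib mult_ac)
  qed
  have "(\<Sum>e\<in>S. w $ e * \<bar>(x + t *\<^sub>R u) $ e\<bar> - w $ e * \<bar>x $ e\<bar>)
      \<le> (\<Sum>e\<in>S. t * (w $ e * \<bar>(x + u) $ e\<bar> - w $ e * \<bar>x $ e\<bar>))"
    by (rule sum_mono) (rule e)
  also have "\<dots> = t * ((\<Sum>e\<in>S. w $ e * \<bar>(x + u) $ e\<bar>) - (\<Sum>e\<in>S. w $ e * \<bar>x $ e\<bar>))"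
    unfolding sum_distrib_left[symmetric] sum_subtractf ..
  finally show ?thesis
    unfolding weighted_l1_def sum_subtractf by (simp add: field_simps)
qed

lemma lasso_oracle_iff: "lasso_oracle l S w \<beta> \<longleftrightarrow> restr (- S) \<beta> = 0 \<and>
    (\<forall>y. restr (- S) y = 0 \<longrightarrow> l \<beta> + weighted_l1 S w \<beta> \<le> l y + weighted_l1 S w y)"
  unfolding lasso_oracle_def by (rule is_arg_min_linorder)

text \<open>
  First-order optimality without subgradients: the penalty is convex, so its increment along a
  segment is at most proportional, while the increment of \<open>l\<close> is linear to first order.
\<close>

lemma lasso_oracle_variational:
  fixes l :: "real^'i \<Rightarrow> real"
  assumes diff: "l differentiable (at b)" and w: "0 \<le> w" and b: "lasso_oracle l S w b"
    and u: "restr (- S) u = 0"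
  shows "0 \<le> gradient l b \<bullet> u + (weighted_l1 S w (b + u) - weighted_l1 S w b)"
proof -
  let ?c = "weighted_l1 S w (b + u) - weighted_l1 S w b"
  have "\<forall>\<^sub>F t in at_right 0. - ?c \<le> (l (b + t *\<^sub>R u) - l b) / t"
    using eventually_at_right_unit
  proof (rule eventually_mono)
    fix t :: real assume t: "0 < t \<and> t < 1"
    have "restr (- S) (b + t *\<^sub>R u) = 0"
      using b u by (simp add: lasso_oracle_iff restr_eq_0_iff)
    then have "l b + weighted_l1 S w b \<le> l (b + t *\<^sub>R u) + weighted_l1 S w (b + t *\<^sub>R u)"
      using b by (simp add: lasso_oracle_iff)
    moreover have "weighted_l1 S w (b + t *\<^sub>R u) - weighted_l1 S w b \<le> t * ?c"
      using t by (intro weighted_l1_segment[OF w]) auto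
    ultimately have "- ?c * t \<le> l (b + t *\<^sub>R u) - l b"
      by (simp add: algebra_simps)
    then show "- ?c \<le> (l (b + t *\<^sub>R u) - l b) / t"
      using t by (simp add: le_divide_eq)
  qed
  then have "- ?c \<le> gradient l b \<bullet> u"
    by (rule tendsto_lowerbound[OF directional_derivative_gradient[OF diff]]) simp
  then show ?thesis by simp
qed

text \<open>
  A dual certificate. At a constrained solution \<open>b\<close> the entries outside \<open>S\<close> cost \<open>M $ e / 2\<close> per unit
  of absolute value, while the linear part of \<open>l\<close> can gain at most \<open>\<bar>gradient l b $ e\<bar>\<close>. Leaving the
  constraint set is therefore strictly unprofitable, which identifies all unconstrained minimizers.
\<close>

lemma penalized_arg_min_iff_lasso_oracle:
  fixes l :: "real^'i \<Rightarrow> real"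
  assumes convex: "convex_on UNIV l" and diff: "l differentiable (at b)" and M: "0 \<le> M"
    and b: "lasso_oracle l S M b"
    and dual: "\<And>e. e \<notin> S \<Longrightarrow> \<bar>gradient l b $ e\<bar> < M $ e / 2"
  shows "is_arg_min (\<lambda>x. l x + weighted_l1 UNIV M x) (\<lambda>_. True) \<beta> \<longleftrightarrow> lasso_oracle l S M \<beta>"
proof -
  let ?G = "gradient l b" and ?f = "\<lambda>x. l x + weighted_l1 UNIV M x"
  let ?gap = "\<lambda>x. \<Sum>e\<in>- S. (M $ e / 2 - \<bar>?G $ e\<bar>) * \<bar>x $ e\<bar>"
  have split: "weighted_l1 UNIV M x = weighted_l1 S M x + (\<Sum>e\<in>- S. M $ e / 2 * \<bar>x $ e\<bar>)" for x
  proof -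
    have "(\<Sum>e\<in>UNIV. M $ e * \<bar>x $ e\<bar>) = (\<Sum>e\<in>S. M $ e * \<bar>x $ e\<bar>) + (\<Sum>e\<in>- S. M $ e * \<bar>x $ e\<bar>)"
      by (subst sum.union_disjoint[symmetric]) auto
    then show ?thesis
      by (simp add: weighted_l1_def sum_divide_distrib add_divide_distrib)
  qed
  have feasible: "?f x = l x + weighted_l1 S M x" if "restr (- S) x = 0" for x
    using that by (simp add: split restr_eq_0_iff)
  have b0: "restr (- S) b = 0"
    using b by (simp add: lasso_oracle_iff)
  have lower: "?f b + ?gap x \<le> ?f x" for x
  proof -
    define u where "u = restr S (x - b)"
    have u0: "restr (- S) u = 0"
      by (simp add: u_def restr_eq_0_iff) (simp add: restr_def)
    have bu: "weighted_l1 S M (b + u) = weighted_l1 S M x"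
      by (simp add: weighted_l1_def u_def restr_def)
    have "?G \<bullet> (x - b) = ?G \<bullet> u + (\<Sum>e\<in>- S. ?G $ e * x $ e)"
    proof -
      have "?G \<bullet> (x - b) - ?G \<bullet> u = (\<Sum>e\<in>UNIV. ?G $ e * (x - b - u) $ e)"
        by (simp add: inner_vec_def right_diff_distrib sum_subtractf)
      also have "\<dots> = (\<Sum>e\<in>- S. ?G $ e * x $ e)"
      proof -
        have "b $ e = 0" if "e \<notin> S" for e
          using b0 that by (simp add: restr_eq_0_iff)
        then show ?thesis
          by (intro sum.mono_neutral_cong_right) (auto simp: u_def restr_def)
      qed
      finally show ?thesis by simp
    qed
    moreover have "(\<Sum>e\<in>- S. - (\<bar>?G $ e\<bar> * \<bar>x $ e\<bar>)) \<le> (\<Sum>e\<in>- S. ?G $ e * x $ e)"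
    proof (rule sum_mono)
      fix e
      show "- (\<bar>?G $ e\<bar> * \<bar>x $ e\<bar>) \<le> ?G $ e * x $ e"
        using abs_ge_minus_self[of "?G $ e * x $ e"] by (simp add: abs_mult)
    qed
    moreover have "l b + ?G \<bullet> (x - b) \<le> l x"
      by (rule convex_ge_linearization[OF convex diff])
    moreover have "0 \<le> ?G \<bullet> u + (weighted_l1 S M x - weighted_l1 S M b)"
      using lasso_oracle_variational[OF diff M b u0] by (simp add: bu)
    moreover have "?gap x = (\<Sum>e\<in>- S. M $ e / 2 * \<bar>x $ e\<bar>) + (\<Sum>e\<in>- S. - (\<bar>?G $ e\<bar> * \<bar>x $ e\<bar>))"
      by (simp add: left_diff_distrib sum_subtractf sum_negf)
    ultimately show ?thesis
      unfolding feasible[OF b0] split[of x] by linarith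
  qed
  have gap_nonneg: "0 \<le> (M $ e / 2 - \<bar>?G $ e\<bar>) * \<bar>x $ e\<bar>" if "e \<in> - S" for e x
    using dual[of e] that by (intro mult_nonneg_nonneg) auto
  show ?thesis
  proof
    assume "is_arg_min ?f (\<lambda>_. True) \<beta>"
    then have min: "?f \<beta> \<le> ?f x" for x
      by (simp add: is_arg_min_linorder)
    have "?gap \<beta> \<le> 0"
      using lower[of \<beta>] min[of b] by linarith
    moreover have "0 \<le> ?gap \<beta>"
      by (rule sum_nonneg) (rule gap_nonneg)
    ultimately have "?gap \<beta> = 0" by linarith
    then have "(M $ e / 2 - \<bar>?G $ e\<bar>) * \<bar>\<beta> $ e\<bar> = 0" if "e \<in> - S" for e
      using that by (subst (asm) sum_nonneg_eq_0_iff) (auto intro: gap_nonneg)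
    then have "\<beta> $ e = 0" if "e \<in> - S" for e
    proof -
      have "M $ e / 2 - \<bar>?G $ e\<bar> \<noteq> 0"
        using dual[of e] that by simp
      then show ?thesis
        using \<open>\<And>e. e \<in> - S \<Longrightarrow> (M $ e / 2 - \<bar>?G $ e\<bar>) * \<bar>\<beta> $ e\<bar> = 0\<close>[OF that]
        by (simp only: mult_eq_0_iff simp_thms abs_eq_0)
    qed
    then have \<beta>0: "restr (- S) \<beta> = 0"
      by (simp add: restr_eq_0_iff)
    then show "lasso_oracle l S M \<beta>"
      unfolding lasso_oracle_iff
    proof (intro conjI allI impI)
      fix y :: "real^'i" assume "restr (- S) y = 0"
      from feasible[OF this] feasible[OF \<beta>0] min[of y]
      show "l \<beta> + weighted_l1 S M \<beta> \<le> l y + weighted_l1 S M y" by linarith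
    qed
  next
    assume \<beta>: "lasso_oracle l S M \<beta>"
    then have "?f \<beta> \<le> ?f b"
      using b0 by (simp add: lasso_oracle_iff feasible)
    moreover have "?f b \<le> ?f x" for x
    proof -
      have "0 \<le> ?gap x"
        by (rule sum_nonneg) (rule gap_nonneg)
      then show ?thesis using lower[of x] by linarith
    qed
    ultimately have "?f \<beta> \<le> ?f x" for x
      by (rule order_trans)
    then show "is_arg_min ?f (\<lambda>_. True) \<beta>"
      by (simp add: is_arg_min_linorder)
  qed
qed

section \<open>The derivative of a concave penalty\<close>

text \<open>
  Compare the tangents at \<open>s\<close> and \<open>t\<close>, each evaluated at the other point.
\<close>

lemma concave_deriv_antimono:
  assumes conc: "concave_on {0..} g" and diff: "\<And>t. 0 < t \<Longrightarrow> g differentiable (at t)"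
    and st: "0 < s" "s < t"
  shows "deriv g t \<le> deriv g (s::real)"
proof -
  have cvx: "convex_on {0..} (\<lambda>x. - g x)"
    using conc by (simp add: concave_on_def)
  have D: "((\<lambda>x. - g x) has_real_derivative - deriv g x) (at x within {0..})" if "0 < x" for x
  proof -
    have "(g has_real_derivative deriv g x) (at x)"
      using diff[OF that] by (simp only: DERIV_deriv_iff_real_differentiable)
    from DERIV_minus[OF this] show ?thesis
      by (rule has_field_derivative_at_within)
  qed
  have above: "- g y - - g x \<ge> - deriv g x * (y - x)" if "0 < x" "0 < y" for x y
    using that by (intro convex_on_imp_above_tangent[OF cvx _ _ _ D]) (auto simp: interior_real_atLeast)
  have "- deriv g s * (t - s) \<le> - deriv g t * (t - s)"
    using above[of s t] above[of t s] st by (simp add: algebra_simps)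
  then show ?thesis
    using st by (simp add: mult_le_cancel_right)
qed

text \<open>
  The derivative decreases away from \<open>0\<close>, so it is bounded by its right limit there.
\<close>

lemma penalty_deriv_le:
  assumes scad: "scad_like a0 a1 b1 b2 \<tau> g" and t: "0 \<le> t"
  shows "penalty_deriv a0 \<tau> g t \<le> a0 * \<tau>"
proof (cases "t = 0")
  case False
  have "\<forall>\<^sub>F s in at_right 0. deriv g t \<le> deriv g s"
    unfolding eventually_at_right_field
    using t False scad by (intro exI[of _ t]) (auto simp: scad_like_def intro: concave_deriv_antimono)
  moreover have "(deriv g \<longlongrightarrow> a0 * \<tau>) (at_right 0)"
    using scad by (simp add: scad_like_def)
  ultimately have "deriv g t \<le> a0 * \<tau>"
    by (intro tendsto_lowerbound) auto
  then show ?thesis using False by (simp add: penalty_deriv_def)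
qed (simp add: penalty_deriv_def)

section \<open>Perturbation of the kernel of a symmetric matrix\<close>

lemma norm_matrix_sq: "(norm (E :: real^'n^'m))\<^sup>2 = (\<Sum>i\<in>UNIV. (norm (E $ i))\<^sup>2)"
  by (simp add: norm_vec_def L2_set_def sum_nonneg)

lemma op_norm_le_frobenius: "op_norm (E :: real^'n^'m) \<le> norm E"
  unfolding op_norm_def
proof (rule onorm_le)
  fix x
  have "(norm (E *v x))\<^sup>2 = (\<Sum>i\<in>UNIV. (E $ i \<bullet> x)\<^sup>2)"
    by (simp add: norm_vec_def L2_set_def sum_nonneg matrix_vector_mul_component)
  also have "\<dots> \<le> (\<Sum>i\<in>UNIV. (norm (E $ i))\<^sup>2 * (norm x)\<^sup>2)"
    by (rule sum_mono) (metis Cauchy_Schwarz_ineq power2_norm_eq_inner)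
  also have "\<dots> = (norm E * norm x)\<^sup>2"
    by (simp add: norm_matrix_sq power_mult_distrib sum_distrib_right)
  finally show "norm (E *v x) \<le> norm E * norm x"
    by (rule power2_le_imp_le) simp
qed

lemma norm_mult_le_op_norm: "norm ((E :: real^'n^'m) *v x) \<le> op_norm E * norm x"
  unfolding op_norm_def by (rule onorm) (rule matrix_vector_mul_bounded_linear)

context orthonormal_basis
begin

lemma frobenius_norm: "(\<Sum>k\<in>UNIV. (norm (E *v u k))\<^sup>2) = (norm (E :: real^'n^'m))\<^sup>2"
proof -
  have "(\<Sum>k\<in>UNIV. (norm (E *v u k))\<^sup>2) = (\<Sum>k\<in>UNIV. \<Sum>i\<in>UNIV. (E $ i \<bullet> u k)\<^sup>2)"
    by (simp add: norm_vec_def L2_set_def sum_nonneg matrix_vector_mul_component)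
  also have "\<dots> = (\<Sum>i\<in>UNIV. \<Sum>k\<in>UNIV. (E $ i \<bullet> u k)\<^sup>2)"
    by (rule sum.swap)
  finally show ?thesis
    by (simp only: parseval[symmetric] norm_matrix_sq)
qed

lemma sum_split_UNIV: "(\<Sum>k\<in>UNIV. f k) = (\<Sum>k\<in>T. f k) + (\<Sum>k\<in>- T. f k :: real)" for T :: "'n set"
  by (subst sum.union_disjoint[symmetric]) auto

text \<open>
  Split \<open>x \<bullet> q\<close> at \<open>T\<close>: outside \<open>T\<close> it pairs \<open>x\<close> with the short part of \<open>q\<close>, so most of it comes from the
  projection of \<open>x\<close> onto the span of the basis vectors in \<open>T\<close>. The test vector \<open>q\<close> is an indicator of a component in
  both applications: exactly in the span in the second step (\<open>\<delta> = 0\<close>), approximately in the first.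
\<close>

lemma projection_lower_bound:
  assumes q: "(\<Sum>k\<in>- T. (q \<bullet> u k)\<^sup>2) \<le> \<delta>\<^sup>2 * (norm q)\<^sup>2" and "0 \<le> \<delta>"
    and x: "norm x * \<delta> * norm q \<le> x \<bullet> q"
  shows "(x \<bullet> q - norm x * \<delta> * norm q)\<^sup>2 \<le> (\<Sum>k\<in>T. (x \<bullet> u k)\<^sup>2) * (norm q)\<^sup>2"
proof -
  let ?in = "\<Sum>k\<in>T. (x \<bullet> u k) * (q \<bullet> u k)" and ?out = "\<Sum>k\<in>- T. (x \<bullet> u k) * (q \<bullet> u k)"
  have xq: "x \<bullet> q = ?in + ?out"
    by (subst parseval_inner) (rule sum_split_UNIV)
  have sub: "(\<Sum>k\<in>I. (y \<bullet> u k)\<^sup>2) \<le> (norm y)\<^sup>2" for I y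
    unfolding parseval by (rule sum_mono2) auto
  have "?out\<^sup>2 \<le> (\<Sum>k\<in>- T. (x \<bullet> u k)\<^sup>2) * (\<Sum>k\<in>- T. (q \<bullet> u k)\<^sup>2)"
    by (rule Cauchy_Schwarz_ineq_sum)
  also have "\<dots> \<le> (norm x)\<^sup>2 * (\<delta>\<^sup>2 * (norm q)\<^sup>2)"
    by (intro mult_mono sub q) (auto intro: sum_nonneg)
  also have "\<dots> = (norm x * \<delta> * norm q)\<^sup>2"
    by (simp add: power_mult_distrib)
  finally have "\<bar>?out\<bar>\<^sup>2 \<le> (norm x * \<delta> * norm q)\<^sup>2"
    by (simp only: power2_abs)
  then have "\<bar>?out\<bar> \<le> norm x * \<delta> * norm q"
    by (rule power2_le_imp_le) (simp add: \<open>0 \<le> \<delta>\<close>)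
  then have "x \<bullet> q - norm x * \<delta> * norm q \<le> ?in"
    using xq by linarith
  then have "(x \<bullet> q - norm x * \<delta> * norm q)\<^sup>2 \<le> ?in\<^sup>2"
    using x by (intro power_mono) auto
  also have "\<dots> \<le> (\<Sum>k\<in>T. (x \<bullet> u k)\<^sup>2) * (\<Sum>k\<in>T. (q \<bullet> u k)\<^sup>2)"
    by (rule Cauchy_Schwarz_ineq_sum)
  also have "\<dots> \<le> (\<Sum>k\<in>T. (x \<bullet> u k)\<^sup>2) * (norm q)\<^sup>2"
    by (intro mult_left_mono sub) (auto intro: sum_nonneg)
  finally show ?thesis .
qed

end

text \<open>
  A symmetric matrix \<open>B\<close> without nonzero eigenvalues below \<open>\<Delta>\<close> is perturbed to \<open>A\<close>. The set \<open>T\<close> selects as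
  many of the smallest eigenvalues of \<open>A\<close> as the kernel of \<open>B\<close> has dimensions.
\<close>

locale spectral_perturbation =
  old: eigenbasis w B \<mu> + new: eigenbasis u A ev
  for w :: "'n::finite \<Rightarrow> real^'n" and B \<mu> u A ev +
  fixes T :: "'n set" and \<Delta> \<eta> :: real
  assumes gap: "\<And>k. \<mu> k \<noteq> 0 \<Longrightarrow> \<Delta> \<le> \<mu> k"
    and card_T: "card T = card {k. \<mu> k = 0}"
    and T_smallest: "\<And>a b. a \<in> T \<Longrightarrow> b \<notin> T \<Longrightarrow> ev a \<le> ev b"
    and perturbation: "\<And>x. norm ((A - B) *v x) \<le> \<eta> * norm x"
    and \<eta>_less: "\<eta> < \<Delta>"
begin

abbreviation Z where "Z \<equiv> {k. \<mu> k = 0}"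

lemma kernel_iff: "B *v y = 0 \<longleftrightarrow> y \<in> span (w ` Z)"
proof -
  have "B *v y = 0 \<longleftrightarrow> y \<in> eigenspace_on UNIV B 0"
    by (simp add: eigenspace_on_def vec_eq_iff matrix_vector_mult_def)
  then show ?thesis by (simp only: old.eigenspace_eq_span)
qed

text \<open>
  There is a vector spanned by the eigenvectors of \<open>A\<close> in \<open>T\<close> and the one at \<open>b\<close> that is orthogonal to the
  kernel of \<open>B\<close>. Its Rayleigh quotient is at least \<open>\<Delta>\<close> for \<open>B\<close> and at most \<open>ev b\<close> for \<open>A\<close>.
\<close>

lemma weyl:
  assumes "b \<notin> T"
  shows "\<Delta> - \<eta> \<le> ev b"
proof -
  let ?X = "span (u ` insert b T)" and ?Y = "span (w ` Z)"
  have "dim ?Y < dim ?X"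
    using assms by (simp add: new.dim_basis_image old.dim_basis_image card_T del: image_insert)
  then obtain x where x: "x \<in> ?X" "x \<noteq> 0" "\<And>y. y \<in> ?Y \<Longrightarrow> x \<bullet> y = 0"
    using exists_orthogonal_in_larger_span[OF subspace_span subspace_span] by blast
  have xw: "x \<bullet> w k = 0" if "\<mu> k = 0" for k
    using that by (intro x(3) span_base) simp
  have xu: "x \<bullet> u k = 0" if "k \<notin> insert b T" for k
    using x(1) that unfolding new.span_basis_iff by blast
  have "\<Delta> * (norm x)\<^sup>2 \<le> x \<bullet> (B *v x)"
    unfolding old.parseval old.quadratic_form sum_distrib_left
  proof (rule sum_mono)
    fix k show "\<Delta> * (x \<bullet> w k)\<^sup>2 \<le> \<mu> k * (x \<bullet> w k)\<^sup>2"
      by (cases "\<mu> k = 0") (simp_all add: xw gap mult_right_mono)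
  qed
  moreover have "x \<bullet> (A *v x) \<le> ev b * (norm x)\<^sup>2"
    unfolding new.parseval new.quadratic_form sum_distrib_left
  proof (rule sum_mono)
    fix k show "ev k * (x \<bullet> u k)\<^sup>2 \<le> ev b * (x \<bullet> u k)\<^sup>2"
    proof (cases "k \<in> insert b T")
      case True
      then have "ev k \<le> ev b" using T_smallest assms by auto
      then show ?thesis by (rule mult_right_mono) simp
    qed (simp add: xu)
  qed
  moreover have "x \<bullet> (B *v x) - x \<bullet> (A *v x) = - (x \<bullet> ((A - B) *v x))"
    by (simp add: matrix_vector_mult_diff_rdistrib inner_diff_right)
  moreover have "- (x \<bullet> ((A - B) *v x)) \<le> norm x * norm ((A - B) *v x)"
    using norm_cauchy_schwarz[of "- x" "(A - B) *v x"] by simp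
  moreover have "norm x * norm ((A - B) *v x) \<le> norm x * (\<eta> * norm x)"
    by (intro mult_left_mono perturbation) simp
  ultimately have "(\<Delta> - \<eta>) * (norm x)\<^sup>2 \<le> ev b * (norm x)\<^sup>2"
    by (simp add: power2_eq_square algebra_simps)
  then show ?thesis
    using \<open>x \<noteq> 0\<close> by (simp add: mult_le_cancel_right)
qed

text \<open>
  On the kernel of \<open>B\<close> the matrices \<open>A\<close> and \<open>A - B\<close> agree, and \<open>A\<close> stretches the coefficients outside \<open>T\<close> by at
  least \<open>\<Delta> - \<eta>\<close>.
\<close>

lemma davis_kahan:
  assumes y: "y \<in> span (w ` Z)"
  shows "(\<Delta> - \<eta>)\<^sup>2 * (\<Sum>k\<in>- T. (y \<bullet> u k)\<^sup>2) \<le> (norm ((A - B) *v y))\<^sup>2"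
proof -
  have "(A - B) *v y = A *v y"
    using y by (simp add: matrix_vector_mult_diff_rdistrib kernel_iff[symmetric])
  have "(\<Delta> - \<eta>)\<^sup>2 * (\<Sum>k\<in>- T. (y \<bullet> u k)\<^sup>2) \<le> (\<Sum>k\<in>- T. (ev k)\<^sup>2 * (y \<bullet> u k)\<^sup>2)"
    unfolding sum_distrib_left
  proof (rule sum_mono)
    fix k assume "k \<in> - T"
    then have "(\<Delta> - \<eta>)\<^sup>2 \<le> (ev k)\<^sup>2"
      using weyl[of k] \<eta>_less by (intro power_mono) auto
    then show "(\<Delta> - \<eta>)\<^sup>2 * (y \<bullet> u k)\<^sup>2 \<le> (ev k)\<^sup>2 * (y \<bullet> u k)\<^sup>2"
      by (rule mult_right_mono) simp
  qed
  also have "\<dots> \<le> (\<Sum>k\<in>UNIV. (ev k)\<^sup>2 * (y \<bullet> u k)\<^sup>2)"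
    by (rule sum_mono2) auto
  finally show ?thesis
    unfolding \<open>(A - B) *v y = A *v y\<close> new.norm_mult_sq .
qed

lemma kernel_nearly_in_span:
  assumes y: "y \<in> span (w ` Z)" and \<delta>: "\<eta> \<le> \<delta> * (\<Delta> - \<eta>)" and "0 \<le> \<eta>"
  shows "(\<Sum>k\<in>- T. (y \<bullet> u k)\<^sup>2) \<le> \<delta>\<^sup>2 * (norm y)\<^sup>2"
proof -
  have pos: "0 < (\<Delta> - \<eta>)\<^sup>2" using \<eta>_less by simp
  have "(norm ((A - B) *v y))\<^sup>2 \<le> (\<delta> * (\<Delta> - \<eta>) * norm y)\<^sup>2"
  proof (rule power_mono)
    have "\<eta> * norm y \<le> \<delta> * (\<Delta> - \<eta>) * norm y"
      using \<delta> by (rule mult_right_mono) simp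
    then show "norm ((A - B) *v y) \<le> \<delta> * (\<Delta> - \<eta>) * norm y"
      using perturbation[of y] by linarith
  qed simp
  with davis_kahan[OF y]
  have "(\<Delta> - \<eta>)\<^sup>2 * (\<Sum>k\<in>- T. (y \<bullet> u k)\<^sup>2) \<le> (\<Delta> - \<eta>)\<^sup>2 * (\<delta>\<^sup>2 * (norm y)\<^sup>2)"
    by (simp add: power_mult_distrib mult_ac)
  then show ?thesis
    using pos by (simp add: mult_le_cancel_left)
qed

text \<open>
  The projection is injective on the kernel, as it loses only a fraction of the norm, and both
  spaces have the same dimension.
\<close>

lemma projection_onto:
  assumes \<delta>: "\<And>y. y \<in> span (w ` Z) \<Longrightarrow> (\<Sum>k\<in>- T. (y \<bullet> u k)\<^sup>2) \<le> \<delta>\<^sup>2 * (norm y)\<^sup>2"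
    and "\<delta>\<^sup>2 < 1" and z: "z \<in> span (u ` T)"
  obtains y where "y \<in> span (w ` Z)" "\<And>k. k \<in> T \<Longrightarrow> y \<bullet> u k = z \<bullet> u k"
proof -
  define f where "f y = (\<Sum>k\<in>T. (y \<bullet> u k) *\<^sub>R u k)" for y
  have lin: "linear f"
    by (rule linearI) (simp_all add: f_def inner_add_left scaleR_add_left sum.distrib scaleR_sum_right)
  have fu: "f y \<bullet> u k = (if k \<in> T then y \<bullet> u k else 0)" for y k
    unfolding f_def by (rule new.inner_family_sum)
  have zero: "y = 0" if y: "y \<in> span (w ` Z)" and "f y = 0" for y
  proof -
    have "y \<bullet> u k = 0" if "k \<in> T" for k
      using fu[of y k] that \<open>f y = 0\<close> by simp
    then have "(norm y)\<^sup>2 = (\<Sum>k\<in>- T. (y \<bullet> u k)\<^sup>2)"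
      unfolding new.parseval by (simp add: new.sum_split_UNIV[of _ T])
    then have "(1 - \<delta>\<^sup>2) * (norm y)\<^sup>2 \<le> 0" using \<delta>[OF y] by (simp add: algebra_simps)
    moreover have "0 < 1 - \<delta>\<^sup>2" using \<open>\<delta>\<^sup>2 < 1\<close> by simp
    ultimately have "\<not> 0 < (norm y)\<^sup>2"
      using mult_pos_pos[of "1 - \<delta>\<^sup>2" "(norm y)\<^sup>2"] not_less by blast
    then show ?thesis by simp
  qed
  have inj: "inj_on f (span (w ` Z))"
  proof (rule inj_onI)
    fix x y assume *: "x \<in> span (w ` Z)" "y \<in> span (w ` Z)" "f x = f y"
    then have "x - y = 0" by - (rule zero, simp_all add: span_diff linear_diff[OF lin])
    then show "x = y" by simp
  qed
  have "f ` span (w ` Z) = span (u ` T)"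
  proof (rule subspace_dim_equal)
    show "subspace (f ` span (w ` Z))" by (intro linear_subspace_image lin subspace_span)
    show "f ` span (w ` Z) \<subseteq> span (u ` T)" by (auto simp: new.span_basis_iff fu)
    have "dim (f ` span (w ` Z)) = dim (span (w ` Z))"
      using inj by (intro dim_image_eq lin) (simp only: span_span)
    then show "dim (span (u ` T)) \<le> dim (f ` span (w ` Z))"
      by (simp add: new.dim_basis_image old.dim_basis_image card_T)
  qed simp
  with z have "z \<in> f ` span (w ` Z)" by (simp only:)
  then obtain y where "z = f y" "y \<in> span (w ` Z)" by (rule imageE)
  then show ?thesis using that[of y] fu[of y] by simp
qed

text \<open>
  The converse smallness: the projection \<open>z\<close> of \<open>x\<close> is by \<open>projection_onto\<close> also the projection of some \<open>y\<close>
  in the kernel. Since \<open>x\<close> is orthogonal to \<open>y\<close>, the squared norm of \<open>z\<close> equals the pairing of \<open>x\<close> with the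
  small part \<open>z - y\<close>.
\<close>

lemma projection_upper_bound:
  assumes \<delta>: "\<And>y. y \<in> span (w ` Z) \<Longrightarrow> (\<Sum>k\<in>- T. (y \<bullet> u k)\<^sup>2) \<le> \<delta>\<^sup>2 * (norm y)\<^sup>2"
    and "\<delta>\<^sup>2 < 1" and x: "\<And>y. y \<in> span (w ` Z) \<Longrightarrow> x \<bullet> y = 0"
  shows "(1 - \<delta>\<^sup>2) * (\<Sum>k\<in>T. (x \<bullet> u k)\<^sup>2) \<le> \<delta>\<^sup>2 * (norm x)\<^sup>2"
proof -
  define m where "m = (\<Sum>k\<in>T. (x \<bullet> u k)\<^sup>2)"
  define z where "z = (\<Sum>k\<in>T. (x \<bullet> u k) *\<^sub>R u k)"
  have zu: "z \<bullet> u k = (if k \<in> T then x \<bullet> u k else 0)" for k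
    unfolding z_def by (rule new.inner_family_sum)
  then have z: "z \<in> span (u ` T)" by (simp add: new.span_basis_iff)
  obtain y where y: "y \<in> span (w ` Z)" and yz: "\<And>k. k \<in> T \<Longrightarrow> y \<bullet> u k = z \<bullet> u k"
    by (rule projection_onto[OF \<delta> \<open>\<delta>\<^sup>2 < 1\<close> z]) blast+
  have yx: "y \<bullet> u k = x \<bullet> u k" if "k \<in> T" for k using yz[OF that] zu that by simp
  let ?out = "\<Sum>k\<in>- T. (x \<bullet> u k) * (y \<bullet> u k)"
  have "0 = (\<Sum>k\<in>T. (x \<bullet> u k) * (y \<bullet> u k)) + ?out"
    using x[OF y] unfolding new.parseval_inner[of x y] by (simp only: new.sum_split_UNIV[of _ T])
  then have m: "m = - ?out"
    by (simp add: m_def yx power2_eq_square)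
  have "m\<^sup>2 \<le> (\<Sum>k\<in>- T. (x \<bullet> u k)\<^sup>2) * (\<Sum>k\<in>- T. (y \<bullet> u k)\<^sup>2)"
    unfolding m power2_minus by (rule Cauchy_Schwarz_ineq_sum)
  also have "\<dots> \<le> (norm x)\<^sup>2 * (\<delta>\<^sup>2 * (norm y)\<^sup>2)"
    unfolding new.parseval[of x] using \<delta>[OF y]
    by (intro mult_mono sum_mono2) (auto intro: sum_nonneg)
  finally have 1: "m\<^sup>2 \<le> \<delta>\<^sup>2 * (norm x)\<^sup>2 * (norm y)\<^sup>2" by (simp add: mult_ac)
  have "(norm y)\<^sup>2 = m + (\<Sum>k\<in>- T. (y \<bullet> u k)\<^sup>2)"
    unfolding new.parseval new.sum_split_UNIV[of _ T] m_def by (simp add: yx)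
  then have 2: "(1 - \<delta>\<^sup>2) * (norm y)\<^sup>2 \<le> m" using \<delta>[OF y] by (simp add: algebra_simps)
  have m0: "0 \<le> m" unfolding m_def by (rule sum_nonneg) simp
  have "m * ((1 - \<delta>\<^sup>2) * m) = (1 - \<delta>\<^sup>2) * m\<^sup>2" by (simp add: power2_eq_square)
  also have "\<dots> \<le> (1 - \<delta>\<^sup>2) * (\<delta>\<^sup>2 * (norm x)\<^sup>2 * (norm y)\<^sup>2)"
    using 1 \<open>\<delta>\<^sup>2 < 1\<close> by (intro mult_left_mono) auto
  also have "\<dots> = \<delta>\<^sup>2 * (norm x)\<^sup>2 * ((1 - \<delta>\<^sup>2) * (norm y)\<^sup>2)" by (simp add: mult_ac)
  also have "\<dots> \<le> \<delta>\<^sup>2 * (norm x)\<^sup>2 * m" using 2 by (intro mult_left_mono) auto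
  finally have "m * ((1 - \<delta>\<^sup>2) * m) \<le> m * (\<delta>\<^sup>2 * (norm x)\<^sup>2)" by (simp add: mult_ac)
  then have "(1 - \<delta>\<^sup>2) * m \<le> \<delta>\<^sup>2 * (norm x)\<^sup>2" if "m \<noteq> 0"
    using that m0 by (simp add: mult_le_cancel_left)
  then show ?thesis unfolding m_def[symmetric] by (cases "m = 0") simp_all
qed

text \<open>
  The Frobenius norms of \<open>(I - Q) P\<close> and \<open>(I - P) Q\<close> agree for two orthogonal projections of equal
  rank: both squares are the rank minus the trace of \<open>P Q\<close>.
\<close>

lemma projection_defects_eq:
  "(\<Sum>a\<in>T. \<Sum>b\<in>- Z. (u a \<bullet> w b)\<^sup>2) = (\<Sum>b\<in>Z. \<Sum>a\<in>- T. (w b \<bullet> u a)\<^sup>2)"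
proof -
  have 1: "(\<Sum>b\<in>- Z. (u a \<bullet> w b)\<^sup>2) = 1 - (\<Sum>b\<in>Z. (u a \<bullet> w b)\<^sup>2)" for a
    using old.parseval[of "u a"] old.sum_split_UNIV[of "\<lambda>b. (u a \<bullet> w b)\<^sup>2" Z] by simp
  have 2: "(\<Sum>a\<in>- T. (w b \<bullet> u a)\<^sup>2) = 1 - (\<Sum>a\<in>T. (w b \<bullet> u a)\<^sup>2)" for b
    using new.parseval[of "w b"] new.sum_split_UNIV[of "\<lambda>a. (w b \<bullet> u a)\<^sup>2" T] by simp
  have "(\<Sum>a\<in>T. \<Sum>b\<in>Z. (u a \<bullet> w b)\<^sup>2) = (\<Sum>b\<in>Z. \<Sum>a\<in>T. (w b \<bullet> u a)\<^sup>2)"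
    by (subst sum.swap) (simp only: inner_commute)
  moreover have "(\<Sum>a\<in>T. 1 :: real) = (\<Sum>b\<in>Z. 1)"
    by (simp only: sum_constant card_T)
  ultimately show ?thesis
    by (simp only: 1 2 sum_subtractf)
qed

lemma frobenius_defect:
  "(\<Delta> - \<eta>)\<^sup>2 * (\<Sum>a\<in>T. \<Sum>b\<in>- Z. (u a \<bullet> w b)\<^sup>2) \<le> (\<Sum>b\<in>Z. (norm ((A - B) *v w b))\<^sup>2)"
  unfolding projection_defects_eq sum_distrib_left[of _ _ Z]
  by (intro sum_mono davis_kahan span_base) auto

end

section \<open>Weights of a vector with separated blocks\<close>

lemma eigen_decomp_iff:
  "eigen_decomp A V ev \<longleftrightarrow> eigenbasis (\<lambda>k. column k V) A (\<lambda>k. ev $ k)"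
proof -
  have "(\<forall>a b. column a V \<bullet> column b V = (if a = b then 1 else 0)) \<longleftrightarrow> orthogonal_matrix V"
    unfolding orthogonal_matrix_orthonormal_columns orthogonal_def norm_eq_1 by auto
  then show ?thesis
    by (simp add: eigen_decomp_def eigenbasis_def orthonormal_basis_def eigenbasis_axioms_def)
qed

lemma eigen_decomp_exists:
  fixes A :: "real^'n^'n"
  assumes "transpose A = A"
  shows "\<exists>V ev. eigen_decomp A V ev"
proof -
  obtain u ev where "eigenbasis u A ev"
    using spectral_theorem[OF assms] .
  moreover have "(\<lambda>k. column k (\<chi> i k. u k $ i)) = u"
    by (simp add: column_def vec_eq_iff fun_eq_iff)
  ultimately have "eigen_decomp A (\<chi> i k. u k $ i) (\<chi> k. ev k)"
    by (simp add: eigen_decomp_iff)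
  then show ?thesis by blast
qed

definition edge_diff :: "'n::finite \<Rightarrow> 'n \<Rightarrow> real^'n" where
  "edge_diff i j = axis i 1 - axis j 1"

lemma inner_edge_diff: "edge_diff i j \<bullet> v = v $ i - v $ j"
  by (simp add: edge_diff_def inner_diff_left inner_axis' )

lemma norm_edge_diff: "i \<noteq> j \<Longrightarrow> norm (edge_diff i j) = sqrt 2"
  unfolding norm_eq_sqrt_inner inner_edge_diff by (simp add: edge_diff_def axis_def)

lemma eig_weights_nth:
  assumes "i \<noteq> j"
  shows "eig_weights V w $ edge_between i j
    = (\<Sum>k\<in>UNIV. w $ k * (edge_diff i j \<bullet> column k V)\<^sup>2)"
  unfolding eig_weights_def inner_edge_diff column_def
  using assms by (subst edge_vec_nth) (simp_all add: power2_commute)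

lemma norm_indicator_vec: "(norm (indicator_vec C))\<^sup>2 = real (card C)"
  by (simp add: power2_norm_eq_inner indicator_vec_inner_self)

lemma adjacency_abs_restr_pairs:
  "adjacency \<bar>restr (pairs_in C) b\<bar> $ i $ j
    = (if i \<in> C \<and> j \<in> C then adjacency \<bar>b\<bar> $ i $ j else 0)"
  by (auto simp: adjacency_nth abs_vec_def restr_def edge_between_in_pairs)

text \<open>
  No edges of \<open>b\<close> leave a component, so the Laplacian acts on each component separately.
\<close>

lemma component_restriction_eigenvector:
  assumes b: "restr (- same_component x) b = 0" and eig: "laplacian \<bar>b\<bar> *v v = c *\<^sub>R v"
    and C: "C \<in> components_of x"
  shows "(\<chi> i. if i \<in> C then v $ i else 0) \<in> eigenspace_on C (laplacian \<bar>restr (pairs_in C) b\<bar>) c"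
proof -
  let ?v = "\<chi> i. if i \<in> C then v $ i else 0" and ?L = "laplacian \<bar>restr (pairs_in C) b\<bar>"
  have "(\<Sum>j\<in>C. ?L $ i $ j * ?v $ j) = c * ?v $ i" if i: "i \<in> C" for i
  proof -
    have "(\<Sum>j\<in>C. ?L $ i $ j * ?v $ j) = (?L *v ?v) $ i"
      unfolding matrix_vector_mult_def vec_lambda_beta
      by (rule sum.mono_neutral_cong_left) auto
    also have "\<dots> = (\<Sum>j\<in>UNIV. adjacency \<bar>b\<bar> $ i $ j * (v $ i - v $ j))"
      unfolding laplacian_mult
    proof (rule sum.cong[OF refl])
      fix j
      show "adjacency \<bar>restr (pairs_in C) b\<bar> $ i $ j * (?v $ i - ?v $ j)
          = adjacency \<bar>b\<bar> $ i $ j * (v $ i - v $ j)"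
      proof (cases "j \<in> C")
        case False
        then have "(i, j) \<notin> connected_in x"
          using mem_component_iff[OF C i] by simp
        then have "adjacency \<bar>b\<bar> $ i $ j = 0"
          by (simp add: adjacency_abs adjacency_zero_off_components[OF b])
        then show ?thesis
          using False by (simp add: adjacency_abs_restr_pairs)
      qed (simp add: adjacency_abs_restr_pairs i)
    qed
    also have "\<dots> = (laplacian \<bar>b\<bar> *v v) $ i"
      by (rule laplacian_mult[symmetric])
    finally show ?thesis
      by (simp add: eig i)
  qed
  then show ?thesis
    by (simp add: eigenspace_on_def)
qed

lemma dim_pos: "s \<in> S \<Longrightarrow> s \<noteq> 0 \<Longrightarrow> 1 \<le> dim (S :: 'a::euclidean_space set)"
proof -
  assume "s \<in> S" "s \<noteq> 0"
  then have "\<not> S \<subseteq> {0}" by auto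
  then have "dim S \<noteq> 0" by (simp only: dim_eq_0 not_False_eq_True)
  then show ?thesis by linarith
qed

text \<open>
  The indicator of a component \<open>C\<close> is an eigenvector of the Laplacian of \<open>C\<close> with eigenvalue \<open>0\<close>. If \<open>v\<close> is
  not constant on \<open>C\<close>, its restriction to \<open>C\<close> is an independent eigenvector, and so the second smallest
  eigenvalue of that Laplacian is at most \<open>c\<close>.
\<close>

lemma eigenvector_blockwise_constant_or_large:
  assumes b: "restr (- same_component x) b = 0" and eig: "laplacian \<bar>b\<bar> *v v = c *\<^sub>R v"
    and gap: "t \<le> min_component_gap x b" and v: "v \<notin> blockwise_constant x"
  shows "t \<le> c"
proof -
  obtain i j where ij: "(i, j) \<in> connected_in x" "v $ i \<noteq> v $ j"
    using v by (auto simp: blockwise_constant_def)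
  define C where "C = connected_in x `` {i}"
  have C: "C \<in> components_of x"
    unfolding C_def by (rule component_in_components)
  have mem: "i \<in> C" "j \<in> C" using ij by (simp_all add: C_def)
  have "card {i, j} \<le> card C"
    using mem by (intro card_mono) auto
  then have "C \<in> nontrivial_components x"
    using C ij by (cases "i = j") (auto simp: nontrivial_components_def)
  then have "min_component_gap x b \<le> eigval_on C 2 (laplacian \<bar>restr (pairs_in C) b\<bar>)"
    unfolding min_component_gap_def by (intro Min_le) auto
  also have "\<dots> \<le> c"
  proof -
    let ?E = "eigenspace_on C (laplacian \<bar>restr (pairs_in C) b\<bar>)"
    let ?v = "\<chi> i. if i \<in> C then v $ i else 0" and ?q = "\<chi> i. if i \<in> C then 1 $ i else (0 :: real)"
    have vE: "?v \<in> ?E c"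
      by (rule component_restriction_eigenvector[OF b eig C])
    have "laplacian \<bar>b\<bar> *v 1 = 0 *\<^sub>R 1"
      by (simp add: vec_eq_iff laplacian_mult)
    then have qE: "?q \<in> ?E 0"
      by (rule component_restriction_eigenvector[OF b _ C])
    have v_span: "?v \<notin> span {?q}"
    proof
      assume "?v \<in> span {?q}"
      then obtain k where "?v = k *\<^sub>R ?q" by (auto simp: span_singleton)
      then have "?v $ i = (k *\<^sub>R ?q) $ i" "?v $ j = (k *\<^sub>R ?q) $ j" by (simp_all only:)
      then show False using ij mem by simp
    qed
    have q0: "?q \<noteq> 0"
    proof
      assume "?q = 0"
      then have "?q $ i = 0 $ i" by (simp only:)
      then show False using mem by simp
    qed
    have v0: "?v \<noteq> 0" using v_span span_zero[of "{?q}"] by auto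
    have "v \<noteq> 0" using ij by auto
    have "0 \<le> c * (v \<bullet> v)"
      using laplacian_psd[of v b] by (simp add: eig)
    moreover have "0 < v \<bullet> v" using \<open>v \<noteq> 0\<close> by simp
    ultimately have "0 \<le> c" by (simp add: zero_le_mult_iff)
    show ?thesis
    proof (cases "c = 0")
      case True
      have "independent {?v, ?q}"
        using v_span q0 by (simp add: independent_insert)
      moreover have "?v \<noteq> ?q" using v_span span_base[of ?q "{?q}"] by auto
      ultimately have "2 \<le> dim (?E 0)"
        using independent_card_le_dim[of "{?v, ?q}" "?E 0"] vE qE True by simp
      then show ?thesis
        using True by (intro eigval_on_le[where S = "{0}"] laplacian_symmetric) auto
    next
      case False
      then show ?thesis
        using dim_pos[OF vE v0] dim_pos[OF qE q0] \<open>0 \<le> c\<close>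
        by (intro eigval_on_le[where S = "{0, c}"] laplacian_symmetric) auto
    qed
  qed
  finally show ?thesis using gap by linarith
qed

text \<open>
  Once the gaps are large, applying \<open>h\<close> to the Laplacian gives \<open>a\<close> times the projection onto its kernel.
  The two parts bound the values of the corresponding quadratic form at differences of unit vectors.
\<close>

lemma block_gap_weights:
  assumes V: "eigen_decomp (laplacian \<bar>b\<bar>) V ev"
    and b: "restr (- same_component x) b = 0"
    and gap: "0 < t" "t \<le> min_component_gap x b"
    and h: "h 0 = a" "0 \<le> a" "\<And>c. t \<le> c \<Longrightarrow> h c = 0" and "i \<noteq> j"
  shows "(i, j) \<in> connected_in x \<Longrightarrow> eig_weights V (\<chi> k. h (ev $ k)) $ edge_between i j = 0"
    and "(i, j) \<notin> connected_in x \<Longrightarrow>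
      a / max_component x \<le> eig_weights V (\<chi> k. h (ev $ k)) $ edge_between i j"
proof -
  let ?u = "\<lambda>k. column k V"
  interpret eigenbasis ?u "laplacian \<bar>b\<bar>" "\<lambda>k. ev $ k"
    using V by (simp add: eigen_decomp_iff)
  define Z where "Z = {k. ev $ k = 0}"
  have const: "?u k \<in> blockwise_constant x" if "ev $ k < t" for k
    using eigenvector_blockwise_constant_or_large[OF b eigen gap(2)] that by fastforce
  have small: "ev $ k = 0" if "ev $ k < t" for k
  proof -
    have "ev $ k *\<^sub>R ?u k = 0"
      using laplacian_blockwise_constant[OF b const[OF that]] eigen[of k] by simp
    moreover have "?u k \<noteq> 0" by (metis norm_basis norm_zero zero_neq_one)
    ultimately show ?thesis by simp
  qed
  have hk: "h (ev $ k) = (if k \<in> Z then a else 0)" for k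
    using small[of k] h by (cases "ev $ k < t") (auto simp: Z_def not_less)
  have "eig_weights V (\<chi> k. h (ev $ k)) $ edge_between i j
      = (\<Sum>k\<in>UNIV. if k \<in> Z then a * (edge_diff i j \<bullet> ?u k)\<^sup>2 else 0)"
    unfolding eig_weights_nth[OF \<open>i \<noteq> j\<close>] by (intro sum.cong) (auto simp: hk)
  then have weight: "eig_weights V (\<chi> k. h (ev $ k)) $ edge_between i j
      = a * (\<Sum>k\<in>Z. (edge_diff i j \<bullet> ?u k)\<^sup>2)"
    by (simp add: sum.If_cases sum_distrib_left)
  show "eig_weights V (\<chi> k. h (ev $ k)) $ edge_between i j = 0" if "(i, j) \<in> connected_in x"
  proof -
    have "edge_diff i j \<bullet> ?u k = 0" if "k \<in> Z" for k
      using const[of k] gap(1) that \<open>(i, j) \<in> connected_in x\<close>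
      by (simp add: inner_edge_diff Z_def blockwise_constant_def)
    then show ?thesis by (simp add: weight)
  qed
  show "a / max_component x \<le> eig_weights V (\<chi> k. h (ev $ k)) $ edge_between i j"
    if "(i, j) \<notin> connected_in x"
  proof -
    define C where "C = connected_in x `` {i}"
    have C: "C \<in> components_of x" and mem: "i \<in> C" "j \<notin> C"
      using that by (simp_all add: C_def component_in_components)
    let ?q = "indicator_vec C"
    have Lq: "laplacian \<bar>b\<bar> *v ?q = 0"
      by (intro laplacian_blockwise_constant[OF b] indicator_vec_blockwise_constant C)
    have "?q \<bullet> ?u k = 0" if "k \<in> - Z" for k
      using mult_inner_basis[of ?q k] that by (simp add: Lq Z_def)
    then have "(\<Sum>k\<in>- Z. (?q \<bullet> ?u k)\<^sup>2) \<le> 0\<^sup>2 * (norm ?q)\<^sup>2" by simp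
    moreover have "edge_diff i j \<bullet> ?q = 1"
      using mem by (simp add: inner_edge_diff indicator_vec_def)
    ultimately have "1 \<le> (\<Sum>k\<in>Z. (edge_diff i j \<bullet> ?u k)\<^sup>2) * card C"
      using projection_lower_bound[where T = Z and q = ?q and \<delta> = 0 and x = "edge_diff i j"] by (simp add: norm_indicator_vec)
    also have "\<dots> \<le> (\<Sum>k\<in>Z. (edge_diff i j \<bullet> ?u k)\<^sup>2) * max_component x"
      using card_component_le[OF C] by (intro mult_left_mono) (auto intro: sum_nonneg)
    finally have "a * 1 \<le> a * ((\<Sum>k\<in>Z. (edge_diff i j \<bullet> ?u k)\<^sup>2) * max_component x)"
      using \<open>0 \<le> a\<close> by (rule mult_left_mono)
    then show ?thesis
      using max_component_pos[of x] unfolding weight by (simp add: divide_le_eq mult_ac)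
  qed
qed

section \<open>Spectrum of the target and of the initial estimate\<close>

lemma eigenbasis_laplacian_nonneg:
  assumes "eigenbasis u (laplacian \<bar>b\<bar>) ev"
  shows "0 \<le> ev k"
proof -
  interpret eigenbasis u "laplacian \<bar>b\<bar>" ev by fact
  show ?thesis
    using laplacian_psd[of "u k" b] by (simp add: eigen orthonormal)
qed

text \<open>
  The gap is the smallest nonzero eigenvalue because the eigenvalue \<open>0\<close> has multiplicity exactly \<open>K\<close>. A
  nonzero target has an edge, so \<open>K < d\<close> and the eigenvalue with index \<open>K + 1\<close> exists.
\<close>

lemma target_spectrum:
  assumes w: "eigenbasis w (laplacian \<bar>x\<bar>) \<mu>" and "x \<noteq> 0"
  shows "span (w ` {k. \<mu> k = 0}) = blockwise_constant x"
    and "card {k. \<mu> k = 0} = num_components x"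
    and "num_components x < CARD('n::card2)"
    and "0 < target_gap (x :: real^('n edge))"
    and "\<mu> k \<noteq> 0 \<Longrightarrow> target_gap x \<le> \<mu> k"
proof -
  interpret eigenbasis w "laplacian \<bar>x\<bar>" \<mu> by fact
  let ?Z = "{k. \<mu> k = 0}"
  have "v \<in> eigenspace_on UNIV (laplacian \<bar>x\<bar>) 0 \<longleftrightarrow> laplacian \<bar>x\<bar> *v v = 0" for v
    by (simp add: eigenspace_on_def vec_eq_iff matrix_vector_mult_def)
  then have "v \<in> eigenspace_on UNIV (laplacian \<bar>x\<bar>) 0 \<longleftrightarrow> v \<in> blockwise_constant x" for v
    using laplacian_kernel laplacian_blockwise_constant[OF supported_on_same_component] by blast
  then have ker: "eigenspace_on UNIV (laplacian \<bar>x\<bar>) 0 = blockwise_constant x"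
    by (rule set_eqI)
  show span: "span (w ` ?Z) = blockwise_constant x"
    using ker by (simp only: eigenspace_eq_span)
  show card: "card ?Z = num_components x"
    using dim_eigenspace[of 0] by (simp only: ker dim_blockwise_constant)
  show less: "num_components x < CARD('n)"
  proof (rule ccontr)
    assume "\<not> num_components x < CARD('n)"
    then have "CARD('n) \<le> card ?Z" by (simp add: card)
    then have "?Z = UNIV" by (intro card_seteq) auto
    then have univ: "blockwise_constant x = UNIV"
      by (simp only: span[symmetric] span_basis)
    obtain e where "x $ e \<noteq> 0"
      using \<open>x \<noteq> 0\<close> by (auto simp: vec_eq_iff)
    obtain i j where ij: "i \<noteq> j" "e = edge_between i j"
      by (rule edge_cases)
    then have "adjacency x $ i $ j \<noteq> 0"
      using \<open>x $ e \<noteq> 0\<close> by (simp add: adjacency_nth)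
    then have c: "(i, j) \<in> connected_in x"
      unfolding connected_in_def by blast
    have "axis i (1 :: real) \<in> blockwise_constant x"
      by (simp add: univ)
    then have "axis i (1 :: real) $ i = axis i 1 $ j"
      using c unfolding blockwise_constant_def by blast
    then show False using ij by (simp add: axis_def)
  qed
  have nonneg: "0 \<le> \<mu> k" for k
    by (rule eigenbasis_laplacian_nonneg[OF w])
  let ?\<Delta> = "target_gap x"
  have le: "num_components x + 1 \<le> card {k. \<mu> k \<le> ?\<Delta>}"
    unfolding target_gap_def using less by (intro card_le_eigval) auto
  show pos: "0 < ?\<Delta>"
  proof (rule ccontr)
    assume "\<not> 0 < ?\<Delta>"
    then have "\<mu> k = 0" if "\<mu> k \<le> ?\<Delta>" for k
      using nonneg[of k] that by linarith
    then have "card {k. \<mu> k \<le> ?\<Delta>} \<le> card ?Z"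
      by (intro card_mono) auto
    then show False using le card by linarith
  qed
  have "card {k. \<mu> k < ?\<Delta>} < num_components x + 1"
    unfolding target_gap_def by (intro card_less_eigval) simp
  then have "card {k. \<mu> k < ?\<Delta>} \<le> card ?Z"
    by (simp add: card)
  moreover have "?Z \<subseteq> {k. \<mu> k < ?\<Delta>}" using pos by auto
  ultimately have "?Z = {k. \<mu> k < ?\<Delta>}"
    by (intro card_seteq) simp_all
  then have eq: "\<mu> k < ?\<Delta> \<longleftrightarrow> \<mu> k = 0" for k
    by auto
  show "?\<Delta> \<le> \<mu> k" if "\<mu> k \<noteq> 0"
    using eq[of k] that by (simp add: not_less)
qed

lemma (in eigenbasis) spectral_clusters:
  assumes K: "1 \<le> K" "K < CARD('n)" and s: "eigval K A \<le> s" and t: "t \<le> eigval (K + 1) A"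
    and "s < t"
  shows "card {k. ev k \<le> s} = K" and "\<not> ev k \<le> s \<Longrightarrow> t \<le> ev k"
proof -
  have "K \<le> card {k. ev k \<le> eigval K A}"
    using K by (intro card_le_eigval) auto
  also have "\<dots> \<le> card {k. ev k \<le> s}"
    using s by (intro card_mono) auto
  finally have ge: "K \<le> card {k. ev k \<le> s}" .
  have "card {k. ev k < t} \<le> card {k. ev k < eigval (K + 1) A}"
    using t by (intro card_mono) auto
  also have "\<dots> < K + 1"
    by (intro card_less_eigval) simp
  finally have le: "card {k. ev k < t} \<le> K" by simp
  have sub: "{k. ev k \<le> s} \<subseteq> {k. ev k < t}"
    using \<open>s < t\<close> by auto
  have "card {k. ev k \<le> s} \<le> card {k. ev k < t}"
    using sub by (intro card_mono) auto
  with ge le show "card {k. ev k \<le> s} = K" by simp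
  have eq: "{k. ev k \<le> s} = {k. ev k < t}"
    using sub ge le by (intro card_seteq) auto
  show "t \<le> ev k" if "\<not> ev k \<le> s"
  proof -
    have "k \<notin> {k. ev k < t}"
      using that unfolding eq[symmetric] by simp
    then show ?thesis by (simp add: not_less)
  qed
qed

text \<open>
  Differences inside a component see only \<open>r\<close>, and each node takes part in at most \<open>max_component x\<close> ordered
  pairs. The factor \<open>4\<close> comes from \<open>(a - b)\<^sup>2 \<le> 2 * a\<^sup>2 + 2 * b\<^sup>2\<close> and is not sharp.
\<close>

lemma sum_sq_within_components:
  assumes "v - r \<in> blockwise_constant x"
  shows "(\<Sum>(i, j)\<in>{(i, j)\<in>connected_in x. i \<noteq> j}. (edge_diff i j \<bullet> v)\<^sup>2)
    \<le> 4 * real (max_component x) * (norm r)\<^sup>2"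
proof -
  let ?P = "{(i, j)\<in>connected_in x. i \<noteq> j}" and ?c = "\<lambda>i. card (connected_in x `` {i})"
  have diff: "v $ i - v $ j = r $ i - r $ j" if "(i, j) \<in> connected_in x" for i j
  proof -
    have "(v - r) $ i = (v - r) $ j"
      using assms that unfolding blockwise_constant_def by blast
    then show ?thesis by simp
  qed
  have sq: "(a - b)\<^sup>2 \<le> 2 * a\<^sup>2 + 2 * b\<^sup>2" for a b :: real
    using zero_le_power2[of "a + b"] by (simp add: power2_sum power2_diff)
  have "(\<Sum>(i, j)\<in>?P. (edge_diff i j \<bullet> v)\<^sup>2) = (\<Sum>(i, j)\<in>?P. (r $ i - r $ j)\<^sup>2)"
    by (intro sum.cong) (auto simp: inner_edge_diff diff)
  also have "\<dots> \<le> (\<Sum>(i, j)\<in>connected_in x. (r $ i - r $ j)\<^sup>2)"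
    by (rule sum_mono2) auto
  also have "\<dots> \<le> (\<Sum>(i, j)\<in>connected_in x. 2 * (r $ i)\<^sup>2 + 2 * (r $ j)\<^sup>2)"
    by (rule sum_mono) (auto intro: sq)
  also have "\<dots> = 2 * (\<Sum>(i, j)\<in>connected_in x. (r $ i)\<^sup>2) + 2 * (\<Sum>(i, j)\<in>connected_in x. (r $ j)\<^sup>2)"
    by (simp add: case_prod_beta sum.distrib sum_distrib_left)
  also have "(\<Sum>(i, j)\<in>connected_in x. (r $ j)\<^sup>2) = (\<Sum>(i, j)\<in>connected_in x. (r $ i)\<^sup>2)"
    by (rule sum.reindex_bij_witness[where i = prod.swap and j = prod.swap])
       (auto intro: connected_in_sym)
  also have "(\<Sum>(i, j)\<in>connected_in x. (r $ i)\<^sup>2)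
      = (\<Sum>(i, j)\<in>(SIGMA i:UNIV. connected_in x `` {i}). (r $ i)\<^sup>2)"
    by (rule arg_cong[where f = "sum _"]) auto
  also have "\<dots> = (\<Sum>i\<in>UNIV. real (?c i) * (r $ i)\<^sup>2)"
    by (subst sum.Sigma[symmetric]) auto
  also have "2 * \<dots> + 2 * \<dots> \<le> 4 * (\<Sum>i\<in>UNIV. real (max_component x) * (r $ i)\<^sup>2)"
  proof -
    have "(\<Sum>i\<in>UNIV. real (?c i) * (r $ i)\<^sup>2) \<le> (\<Sum>i\<in>UNIV. real (max_component x) * (r $ i)\<^sup>2)"
      using card_component_le[OF component_in_components, of x]
      by (intro sum_mono mult_right_mono) auto
    then show ?thesis by simp
  qed
  also have "\<dots> = 4 * real (max_component x) * (norm r)\<^sup>2"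
    by (simp add: sum_distrib_left norm_vec_def L2_set_def sum_nonneg mult_ac)
  finally show ?thesis .
qed

lemma infnorm_le: "(\<And>i. \<bar>x $ i\<bar> \<le> c) \<Longrightarrow> infnorm (x :: real^'n) \<le> c"
  unfolding infnorm_cart by (rule cSup_least) auto

section \<open>Weights of the first step\<close>

text \<open>
  The function \<open>h\<close> stands for the derivative of the penalty, with values in \<open>[lo, hi]\<close> up to \<open>s\<close> and \<open>0\<close> from \<open>t\<close>
  on; \<open>\<delta>\<close> bounds the relative perturbation. The bound \<open>1 / 2 ^ 6\<close> turns \<open>\<delta> / (1 - \<delta>)\<close> into at most
  \<open>64 / 63 * \<delta>\<close>, the constant that appears below.
\<close>

locale first_step =
  fixes target \<beta>0 :: "real^('n::card2 edge)" and V :: "real^('n::card2)^('n::card2)" and ev :: "real^('n::card2)"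
    and h :: "real \<Rightarrow> real" and lo hi s t \<delta> :: real
  assumes target: "target \<noteq> 0"
    and V: "eigen_decomp (laplacian \<bar>\<beta>0\<bar>) V ev"
    and low: "eigval (num_components target) (laplacian \<bar>\<beta>0\<bar>) \<le> s"
    and high: "t \<le> eigval (num_components target + 1) (laplacian \<bar>\<beta>0\<bar>)"
    and s_t: "s < t"
    and h_low: "\<And>c. 0 \<le> c \<Longrightarrow> c \<le> s \<Longrightarrow> lo \<le> h c \<and> h c \<le> hi"
    and h_high: "\<And>c. t \<le> c \<Longrightarrow> h c = 0"
    and lo: "0 \<le> lo" and hi: "0 \<le> hi"
    and \<delta>: "0 \<le> \<delta>" "\<delta> * sqrt (max_component target) \<le> 1 / 2 ^ 6"
    and op: "op_norm (laplacian (\<bar>\<beta>0\<bar> - \<bar>target\<bar>)) \<le> target_gap target * \<delta>"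
begin

abbreviation M where "M \<equiv> eig_weights V (\<chi> k. h (ev $ k))"

abbreviation u where "u \<equiv> \<lambda>k. column k V"

definition T where "T = {k. ev $ k \<le> s}"

abbreviation m where "m x \<equiv> \<Sum>k\<in>T. (x \<bullet> u k)\<^sup>2"

sublocale new: eigenbasis u "laplacian \<bar>\<beta>0\<bar>" "\<lambda>k. ev $ k"
  using V by (simp add: eigen_decomp_iff)

lemma \<delta>_le: "\<delta> \<le> 1 / 2 ^ 6"
proof -
  have "\<delta> * 1 \<le> \<delta> * sqrt (max_component target)"
    using \<delta>(1) max_component_pos[of target] by (intro mult_left_mono) auto
  then show ?thesis using \<delta>(2) by linarith
qed

lemma perturbation:
  assumes w: "eigenbasis w (laplacian \<bar>target\<bar>) \<mu>"
  shows "spectral_perturbation w (laplacian \<bar>target\<bar>) \<mu> u (laplacian \<bar>\<beta>0\<bar>) (\<lambda>k. ev $ k) T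
    (target_gap target) (target_gap target * \<delta>)"
proof -
  interpret old: eigenbasis w "laplacian \<bar>target\<bar>" \<mu> by fact
  note spec = target_spectrum[OF w target]
  note clusters = new.spectral_clusters[OF num_components_pos spec(3) low high s_t]
  show ?thesis
  proof
    show "card T = card {k. \<mu> k = 0}"
      unfolding T_def by (simp only: clusters(1) spec(2))
    fix a b assume "a \<in> T" "b \<notin> T"
    then show "ev $ a \<le> ev $ b" by (simp add: T_def)
  next
    fix x
    have "norm ((laplacian \<bar>\<beta>0\<bar> - laplacian \<bar>target\<bar>) *v x)
        \<le> op_norm (laplacian (\<bar>\<beta>0\<bar> - \<bar>target\<bar>)) * norm x"
      unfolding laplacian_diff[symmetric] by (rule norm_mult_le_op_norm)
    also have "\<dots> \<le> target_gap target * \<delta> * norm x"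
      using op by (rule mult_right_mono) simp
    finally show "norm ((laplacian \<bar>\<beta>0\<bar> - laplacian \<bar>target\<bar>) *v x) \<le> target_gap target * \<delta> * norm x" .
  next
    have "target_gap target * \<delta> < target_gap target * 1"
      using spec(4) \<delta>_le by (intro mult_strict_left_mono) auto
    then show "target_gap target * \<delta> < target_gap target" by simp
  qed (rule spec(5))
qed

lemma kernel_nearly_kept:
  assumes y: "y \<in> blockwise_constant target"
  shows "(\<Sum>k\<in>- T. (y \<bullet> u k)\<^sup>2) \<le> (64 / 63 * \<delta>)\<^sup>2 * (norm y)\<^sup>2"
proof -
  obtain w \<mu> where w: "eigenbasis w (laplacian \<bar>target\<bar>) \<mu>"
    using spectral_theorem[OF laplacian_symmetric] .
  interpret spectral_perturbation w "laplacian \<bar>target\<bar>" \<mu> u "laplacian \<bar>\<beta>0\<bar>" "\<lambda>k. ev $ k" T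
      "target_gap target" "target_gap target * \<delta>"
    by (rule perturbation[OF w])
  have pos: "0 < target_gap target" by (rule target_spectrum(4)[OF w target])
  have "\<delta> * (63 / 64) \<le> \<delta> * (1 - \<delta>)"
    using \<delta>(1) \<delta>_le by (intro mult_left_mono) auto
  then have "target_gap target * \<delta> \<le> target_gap target * (64 / 63 * \<delta> * (1 - \<delta>))"
    using pos by (intro mult_left_mono) auto
  also have "\<dots> = 64 / 63 * \<delta> * (target_gap target - target_gap target * \<delta>)"
    by (simp add: algebra_simps)
  finally show ?thesis
    using y pos \<delta>(1) by (intro kernel_nearly_in_span) (simp_all add: target_spectrum(1)[OF w target])
qed

lemma weight_bounds:
  assumes "i \<noteq> j"
  shows "lo * m (edge_diff i j) \<le> M $ edge_between i j"
    and "M $ edge_between i j \<le> hi * m (edge_diff i j)"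
proof -
  let ?x = "edge_diff i j"
  have nonneg: "0 \<le> ev $ k" for k
    by (rule eigenbasis_laplacian_nonneg[OF new.eigenbasis_axioms])
  obtain w \<mu> where w: "eigenbasis w (laplacian \<bar>target\<bar>) \<mu>"
    using spectral_theorem[OF laplacian_symmetric] .
  note clusters = new.spectral_clusters[OF num_components_pos target_spectrum(3)[OF w target] low high s_t]
  have "M $ edge_between i j = (\<Sum>k\<in>T. h (ev $ k) * (?x \<bullet> u k)\<^sup>2)"
    unfolding eig_weights_nth[OF assms] vec_lambda_beta
    using h_high clusters(2) by (intro sum.mono_neutral_right) (auto simp: T_def)
  moreover have "lo * (?x \<bullet> u k)\<^sup>2 \<le> h (ev $ k) * (?x \<bullet> u k)\<^sup>2
      \<and> h (ev $ k) * (?x \<bullet> u k)\<^sup>2 \<le> hi * (?x \<bullet> u k)\<^sup>2" if "k \<in> T" for k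
    using h_low[OF nonneg[of k]] that by (auto simp: T_def intro!: mult_right_mono)
  ultimately show "lo * m ?x \<le> M $ edge_between i j" "M $ edge_between i j \<le> hi * m ?x"
    unfolding sum_distrib_left by (auto intro!: sum_mono)
qed

lemma weight_nonneg: "0 \<le> M"
  unfolding less_eq_vec_def
proof
  fix e :: "'n edge"
  obtain i j where ij: "i \<noteq> j" "e = edge_between i j"
    by (rule edge_cases)
  have "0 \<le> lo * m (edge_diff i j)"
    using lo by (intro mult_nonneg_nonneg sum_nonneg) auto
  then show "0 $ e \<le> M $ e"
    using weight_bounds(1)[OF ij(1)] ij(2) by simp
qed

text \<open>
  The test vector is the indicator of the component of \<open>i\<close>; its norm is at most the square root of
  \<open>max_component target\<close>, which the bound on \<open>\<delta>\<close> compensates.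
\<close>

lemma weight_between_components:
  assumes "e \<notin> same_component target"
  shows "lo / (2 * real (max_component target)) \<le> M $ e"
proof -
  obtain i j where ij: "i \<noteq> j" "e = edge_between i j"
    by (rule edge_cases)
  define C where "C = connected_in target `` {i}"
  have "(i, j) \<notin> connected_in target"
    using assms ij by (simp add: edge_in_same_component)
  then have C: "C \<in> components_of target" and mem: "i \<in> C" "j \<notin> C"
    by (simp_all add: C_def component_in_components)
  let ?x = "edge_diff i j" and ?q = "indicator_vec C" and ?d = "real (max_component target)"
  have xq: "?x \<bullet> ?q = 1"
    using mem by (simp add: inner_edge_diff indicator_vec_def)
  have d: "1 \<le> ?d" using max_component_pos[of target] by simp
  have q_d: "(norm ?q)\<^sup>2 \<le> ?d"
    using card_component_le[OF C] by (simp add: norm_indicator_vec)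
  then have "norm ?q \<le> sqrt ?d" by (simp add: real_le_rsqrt)
  then have "\<delta> * norm ?q \<le> 1 / 64"
    using mult_left_mono[of "norm ?q" "sqrt ?d" \<delta>] \<delta> by simp
  \<comment> \<open>Any bound on \<open>sqrt 2\<close> below \<open>63 / 40\<close> gives the deviation \<open>1 / 40\<close> below.\<close>
  moreover have "sqrt 2 \<le> 3 / (2 :: real)"
    by (rule real_le_lsqrt) (auto simp: power2_eq_square)
  ultimately have "sqrt 2 * (\<delta> * norm ?q) \<le> 3 / 2 * (1 / 64)"
    using \<delta>(1) by (intro mult_mono) auto
  then have small: "norm ?x * (64 / 63 * \<delta>) * norm ?q \<le> 1 / 40"
    using norm_edge_diff[OF ij(1)] by simp
  have "(?x \<bullet> ?q - norm ?x * (64 / 63 * \<delta>) * norm ?q)\<^sup>2 \<le> m ?x * (norm ?q)\<^sup>2"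
    using kernel_nearly_kept[OF indicator_vec_blockwise_constant[OF C]] \<delta>(1) small
    by (intro new.projection_lower_bound) (simp_all add: xq)
  moreover have "(39 / 40)\<^sup>2 \<le> (?x \<bullet> ?q - norm ?x * (64 / 63 * \<delta>) * norm ?q)\<^sup>2"
    using small by (intro power_mono) (simp_all add: xq)
  moreover have "1 / 2 \<le> ((39 / 40)\<^sup>2 :: real)" by (simp add: power2_eq_square)
  moreover have "m ?x * (norm ?q)\<^sup>2 \<le> m ?x * ?d"
    using q_d by (rule mult_left_mono) (rule sum_nonneg, simp)
  ultimately have "1 / 2 \<le> m ?x * ?d" by linarith
  then have "1 / (2 * ?d) \<le> m ?x"
    using d by (simp add: field_simps)
  then have "lo * (1 / (2 * ?d)) \<le> lo * m ?x"
    using lo by (rule mult_left_mono)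
  then show ?thesis
    using weight_bounds(1)[OF ij(1)] ij(2) by simp
qed

lemma \<delta>_sq_le: "(64 / 63 * \<delta>)\<^sup>2 \<le> 1 / 2"
proof -
  have "(64 / 63 * \<delta>)\<^sup>2 \<le> (1 / 2)\<^sup>2"
    using \<delta>(1) \<delta>_le by (intro power_mono) auto
  then show ?thesis by (simp add: power2_eq_square)
qed

text \<open>
  The difference of two unit vectors in one component is orthogonal to the kernel.
\<close>

lemma weight_within_component:
  assumes "e \<in> same_component target"
  shows "M $ e \<le> 2 ^ 5 * hi * \<delta>\<^sup>2"
proof -
  obtain i j where ij: "i \<noteq> j" "e = edge_between i j"
    by (rule edge_cases)
  then have c: "(i, j) \<in> connected_in target"
    using assms by (simp add: edge_in_same_component)
  obtain w \<mu> where w: "eigenbasis w (laplacian \<bar>target\<bar>) \<mu>"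
    using spectral_theorem[OF laplacian_symmetric] .
  interpret spectral_perturbation w "laplacian \<bar>target\<bar>" \<mu> u "laplacian \<bar>\<beta>0\<bar>" "\<lambda>k. ev $ k" T
      "target_gap target" "target_gap target * \<delta>"
    by (rule perturbation[OF w])
  let ?x = "edge_diff i j" and ?\<epsilon> = "64 / 63 * \<delta>"
  have "(1 - ?\<epsilon>\<^sup>2) * m ?x \<le> ?\<epsilon>\<^sup>2 * (norm ?x)\<^sup>2"
  proof (rule projection_upper_bound)
    show "?\<epsilon>\<^sup>2 < 1" using \<delta>_sq_le by linarith
    fix y assume "y \<in> span (w ` {k. \<mu> k = 0})"
    then have y: "y \<in> blockwise_constant target"
      by (simp only: target_spectrum(1)[OF w target])
    then show "(\<Sum>k\<in>- T. (y \<bullet> u k)\<^sup>2) \<le> ?\<epsilon>\<^sup>2 * (norm y)\<^sup>2"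
      by (rule kernel_nearly_kept)
    show "?x \<bullet> y = 0"
      using y c by (simp add: inner_edge_diff blockwise_constant_def)
  qed
  moreover have "1 / 2 * m ?x \<le> (1 - ?\<epsilon>\<^sup>2) * m ?x"
    using \<delta>_sq_le by (intro mult_right_mono sum_nonneg) auto
  moreover have "?\<epsilon>\<^sup>2 * (norm ?x)\<^sup>2 \<le> 16 * \<delta>\<^sup>2"
    using norm_edge_diff[OF ij(1)] by (simp add: power_mult_distrib power_divide)
  ultimately have "m ?x \<le> 2 ^ 5 * \<delta>\<^sup>2" by simp
  then have "hi * m ?x \<le> hi * (2 ^ 5 * \<delta>\<^sup>2)"
    using hi by (rule mult_left_mono)
  then show ?thesis
    using weight_bounds(2)[OF ij(1)] ij(2) by simp
qed

text \<open>
  Replacing each eigenvector \<open>u a\<close> by its part \<open>r\<close> orthogonal to the kernel changes no difference inside a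
  component, and the squared norms of these parts add up to the squared Frobenius defect, which is
  bounded by the action of the perturbation on an orthonormal basis of the kernel.
\<close>

lemma weight_l1_within_components:
  assumes F: "min (norm (laplacian (\<bar>\<beta>0\<bar> - \<bar>target\<bar>)))
      (sqrt (num_components target) * op_norm (laplacian (\<bar>\<beta>0\<bar> - \<bar>target\<bar>)))
    \<le> target_gap target * \<delta>"
  shows "(\<Sum>e\<in>same_component target. M $ e) \<le> 2 ^ 4 * real (max_component target) * hi * \<delta>\<^sup>2"
proof -
  obtain w \<mu> where w: "eigenbasis w (laplacian \<bar>target\<bar>) \<mu>"
    using spectral_theorem[OF laplacian_symmetric] .
  interpret spectral_perturbation w "laplacian \<bar>target\<bar>" \<mu> u "laplacian \<bar>\<beta>0\<bar>" "\<lambda>k. ev $ k" T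
      "target_gap target" "target_gap target * \<delta>"
    by (rule perturbation[OF w])
  note spec = target_spectrum[OF w target]
  let ?E = "laplacian (\<bar>\<beta>0\<bar> - \<bar>target\<bar>)" and ?Z = "{k. \<mu> k = 0}" and ?\<Delta> = "target_gap target"
  let ?D = "\<Sum>a\<in>T. \<Sum>b\<in>- ?Z. (u a \<bullet> w b)\<^sup>2" and ?d = "real (max_component target)"
  have E: "laplacian \<bar>\<beta>0\<bar> - laplacian \<bar>target\<bar> = ?E" by (rule laplacian_diff[symmetric])
  have \<Delta>\<delta>: "0 \<le> ?\<Delta> * \<delta>" using spec(4) \<delta>(1) by simp
  have frob: "(\<Sum>b\<in>?Z. (norm (?E *v w b))\<^sup>2) \<le> (?\<Delta> * \<delta>)\<^sup>2"
  proof (cases "norm ?E \<le> ?\<Delta> * \<delta>")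
    case True
    have "(\<Sum>b\<in>?Z. (norm (?E *v w b))\<^sup>2) \<le> (norm ?E)\<^sup>2"
      unfolding old.frobenius_norm[symmetric] by (rule sum_mono2) auto
    also have "\<dots> \<le> (?\<Delta> * \<delta>)\<^sup>2" using True by (rule power_mono) simp
    finally show ?thesis .
  next
    case False
    then have op': "sqrt (num_components target) * op_norm ?E \<le> ?\<Delta> * \<delta>"
      using F by (simp add: min_le_iff_disj)
    have op0: "0 \<le> op_norm ?E"
      using order_trans[OF norm_ge_zero norm_mult_le_op_norm[of ?E "w undefined"]] by simp
    have "(norm (?E *v w b))\<^sup>2 \<le> (op_norm ?E)\<^sup>2" for b
      using norm_mult_le_op_norm[of ?E "w b"] by (intro power_mono) auto
    then have "(\<Sum>b\<in>?Z. (norm (?E *v w b))\<^sup>2) \<le> (\<Sum>b\<in>?Z. (op_norm ?E)\<^sup>2)"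
      by (intro sum_mono)
    also have "\<dots> = (sqrt (num_components target) * op_norm ?E)\<^sup>2"
      by (simp only: sum_constant spec(2)) (simp add: power_mult_distrib)
    also have "\<dots> \<le> (?\<Delta> * \<delta>)\<^sup>2"
      using op' op0 by (intro power_mono) auto
    finally show ?thesis .
  qed
  have "(?\<Delta> * (63 / 64))\<^sup>2 * ?D \<le> (?\<Delta> - ?\<Delta> * \<delta>)\<^sup>2 * ?D"
  proof (rule mult_right_mono)
    have "?\<Delta> * (63 / 64) \<le> ?\<Delta> * (1 - \<delta>)"
      using spec(4) \<delta>_le by (intro mult_left_mono) auto
    then show "(?\<Delta> * (63 / 64))\<^sup>2 \<le> (?\<Delta> - ?\<Delta> * \<delta>)\<^sup>2"
      using spec(4) by (intro power_mono) (auto simp: algebra_simps)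
  qed (intro sum_nonneg, simp)
  also have "\<dots> \<le> (\<Sum>b\<in>?Z. (norm (?E *v w b))\<^sup>2)"
    using frobenius_defect unfolding E .
  also note frob
  finally have "?\<Delta>\<^sup>2 * ((63 / 64)\<^sup>2 * ?D) \<le> ?\<Delta>\<^sup>2 * \<delta>\<^sup>2"
    by (simp only: power_mult_distrib mult.assoc)
  then have "(63 / 64)\<^sup>2 * ?D \<le> \<delta>\<^sup>2"
    using spec(4) by (simp add: mult_le_cancel_left)
  moreover have "0 \<le> ?D" by (intro sum_nonneg) simp
  ultimately have D: "?D \<le> 8 * \<delta>\<^sup>2" by (simp add: power2_eq_square)
  let ?P = "{(i, j)\<in>connected_in target. i \<noteq> j}"
  have within: "(\<Sum>(i, j)\<in>?P. (edge_diff i j \<bullet> u a)\<^sup>2) \<le> 4 * ?d * (\<Sum>b\<in>- ?Z. (u a \<bullet> w b)\<^sup>2)" for a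
  proof -
    define r where "r = (\<Sum>b\<in>- ?Z. (u a \<bullet> w b) *\<^sub>R w b)"
    have rw: "r \<bullet> w b = (if b \<in> - ?Z then u a \<bullet> w b else 0)" for b
      unfolding r_def by (rule old.inner_family_sum)
    have "u a - r \<in> span (w ` ?Z)"
      by (simp add: old.span_basis_iff inner_diff_left rw)
    then have "u a - r \<in> blockwise_constant target" by (simp only: spec(1))
    then have "(\<Sum>(i, j)\<in>?P. (edge_diff i j \<bullet> u a)\<^sup>2) \<le> 4 * ?d * (norm r)\<^sup>2"
      by (rule sum_sq_within_components)
    also have "(norm r)\<^sup>2 = (\<Sum>b\<in>- ?Z. (u a \<bullet> w b)\<^sup>2)"
      unfolding old.parseval by (rule sum.mono_neutral_cong_right) (simp_all add: rw)
    finally show ?thesis .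
  qed
  have "2 * (\<Sum>e\<in>same_component target. M $ e) = (\<Sum>(i, j)\<in>?P. M $ edge_between i j)"
    by (rule sum_same_component)
  also have "\<dots> \<le> (\<Sum>(i, j)\<in>?P. hi * m (edge_diff i j))"
    by (rule sum_mono) (auto intro: weight_bounds(2))
  also have "\<dots> = hi * (\<Sum>k\<in>T. \<Sum>(i, j)\<in>?P. (edge_diff i j \<bullet> u k)\<^sup>2)"
    unfolding case_prod_beta sum_distrib_left[symmetric] by (subst sum.swap) simp
  also have "\<dots> \<le> hi * (\<Sum>k\<in>T. 4 * ?d * (\<Sum>b\<in>- ?Z. (u k \<bullet> w b)\<^sup>2))"
    using hi by (intro mult_left_mono sum_mono within)
  also have "\<dots> = hi * (4 * ?d) * ?D"
    by (simp add: sum_distrib_left mult_ac)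
  also have "\<dots> \<le> hi * (4 * ?d) * (8 * \<delta>\<^sup>2)"
    using D hi by (intro mult_left_mono) auto
  finally show ?thesis by (simp add: mult_ac)
qed

end

section \<open>Results of LLA steps\<close>

lemma lasso_oracle_restr: "lasso_oracle l S (restr S w) = lasso_oracle l S w"
proof -
  have "weighted_l1 S (restr S w) = weighted_l1 S w"
    by (simp add: fun_eq_iff weighted_l1_def restr_def)
  then show ?thesis
    by (simp add: fun_eq_iff lasso_oracle_iff)
qed

lemma lasso_oracle_zero_weight:
  assumes "\<And>e. e \<in> S \<Longrightarrow> w $ e = 0"
  shows "lasso_oracle l S w \<beta> \<longleftrightarrow> block_oracle l S \<beta>"
proof -
  have "weighted_l1 S w x = 0" for x
    using assms by (simp add: weighted_l1_def)
  then show ?thesis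
    unfolding lasso_oracle_def block_oracle_def by simp
qed

text \<open>
  The weights vanish inside components, so the constrained problem is the block oracle problem, and the
  weights between components certify its solution.
\<close>

lemma lla_step_from_well_separated_blocks:
  fixes l :: "real^('n::card2 edge) \<Rightarrow> real"
  assumes convex: "convex_on UNIV l" and diff: "\<And>x. l differentiable (at x)"
    and block: "\<And>\<beta>. block_oracle l (same_component x) \<beta> \<longleftrightarrow> \<beta> = \<beta>o"
    and grad: "infnorm (restr (- same_component x) (gradient l \<beta>o)) < a / (2 * real (max_component x))"
    and b: "restr (- same_component x) b = 0" and gap: "0 < t" "t \<le> min_component_gap x b"
    and h: "h 0 = a" "0 \<le> a" "\<And>c. t \<le> c \<Longrightarrow> h c = 0"
  shows "lla_step l h b \<beta> \<longleftrightarrow> \<beta> = \<beta>o"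
proof -
  have step: "is_arg_min (\<lambda>\<beta>. l \<beta> + weighted_l1 UNIV (eig_weights V (\<chi> k. h (ev $ k))) \<beta>) (\<lambda>_. True) \<beta>
      \<longleftrightarrow> \<beta> = \<beta>o" (is "is_arg_min (\<lambda>\<beta>. l \<beta> + weighted_l1 UNIV ?M \<beta>) _ _ \<longleftrightarrow> _")
    if V: "eigen_decomp (laplacian \<bar>b\<bar>) V ev" for V ev
  proof -
    have within: "?M $ e = 0" if "e \<in> same_component x" for e
    proof -
      obtain i j where ij: "i \<noteq> j" "e = edge_between i j"
        by (rule edge_cases)
      then show ?thesis
        using block_gap_weights(1)[where h = h, OF V b gap h ij(1)] that by (simp add: edge_in_same_component)
    qed
    have between: "a / max_component x \<le> ?M $ e" if "e \<notin> same_component x" for e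
    proof -
      obtain i j where ij: "i \<noteq> j" "e = edge_between i j"
        by (rule edge_cases)
      then show ?thesis
        using block_gap_weights(2)[where h = h, OF V b gap h ij(1)] that by (simp add: edge_in_same_component)
    qed
    have pos: "0 \<le> a / max_component x" using h(2) by simp
    have "0 \<le> ?M"
      unfolding less_eq_vec_def
    proof
      fix e show "0 $ e \<le> ?M $ e"
        using within[of e] between[of e] pos by (cases "e \<in> same_component x") auto
    qed
    moreover have "lasso_oracle l (same_component x) ?M \<beta>' \<longleftrightarrow> \<beta>' = \<beta>o" for \<beta>'
      using lasso_oracle_zero_weight[of "same_component x" ?M] within block by blast
    moreover have "\<bar>gradient l \<beta>o $ e\<bar> < ?M $ e / 2" if "e \<notin> same_component x" for e
    proof -
      have "\<bar>gradient l \<beta>o $ e\<bar> \<le> infnorm (restr (- same_component x) (gradient l \<beta>o))"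
        using component_le_infnorm_cart[of "restr (- same_component x) (gradient l \<beta>o)" e] that
        by (simp add: restr_def)
      then show ?thesis using grad between[OF that] by simp
    qed
    ultimately show ?thesis
      using penalized_arg_min_iff_lasso_oracle[OF convex diff, of ?M "same_component x" \<beta>o \<beta>] by blast
  qed
  obtain V ev where "eigen_decomp (laplacian \<bar>b\<bar>) V ev"
    using eigen_decomp_exists[OF laplacian_symmetric] by blast
  then show ?thesis
    unfolding lla_step_def using step by blast
qed

text \<open>
  The weights outside \<open>S\<close> certify a solution of the constrained problem with the weights on \<open>S\<close>. Any
  unconstrained minimizer then solves that problem too.
\<close>

lemma lla_step_into_lasso_oracles:
  fixes l :: "real^('n::card2 edge) \<Rightarrow> real"
  assumes convex: "convex_on UNIV l" and diff: "\<And>x. l differentiable (at x)"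
    and lasso: "\<exists>\<beta>. lasso_oracle l S (restr S M) \<beta>"
    and M: "0 \<le> M" "\<And>e. e \<notin> S \<Longrightarrow> c \<le> M $ e"
    and in_B: "\<And>\<beta>. lasso_oracle l S (restr S M) \<beta> \<Longrightarrow> \<beta> \<in> B"
    and grad: "\<And>\<beta>. \<beta> \<in> B \<Longrightarrow> infnorm (restr (- S) (gradient l \<beta>)) < c / 2"
    and min: "is_arg_min (\<lambda>\<beta>. l \<beta> + weighted_l1 UNIV M \<beta>) (\<lambda>_. True) \<beta>"
  shows "\<beta> \<in> B"
proof -
  obtain b where b: "lasso_oracle l S (restr S M) b" using lasso by blast
  have "\<bar>gradient l b $ e\<bar> < M $ e / 2" if "e \<notin> S" for e
  proof -
    have "\<bar>gradient l b $ e\<bar> \<le> infnorm (restr (- S) (gradient l b))"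
      using component_le_infnorm_cart[of "restr (- S) (gradient l b)" e] that by (simp add: restr_def)
    then show ?thesis using grad[OF in_B[OF b]] M(2)[OF that] by simp
  qed
  then have "lasso_oracle l S M \<beta>"
    using penalized_arg_min_iff_lasso_oracle[OF convex diff M(1), of S b \<beta>] b min
    by (simp add: lasso_oracle_restr)
  then show ?thesis using in_B by (simp add: lasso_oracle_restr)
qed

theorem theorem3p2:
  fixes l :: "real^('n::card2 edge) \<Rightarrow> real"
    and g :: "real \<Rightarrow> real"
    and a0 a1 b1 b2 \<tau> \<rho> :: real
    and target \<beta>o \<beta>0 \<beta>1 :: "real^('n edge)"
  assumes "a0 \<ge> a1" and "a1 > 0" and "b2 > b1" and "b1 > 0"
    and scad: "scad_like a0 a1 b1 b2 \<tau> g"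
    and convex: "convex_on UNIV l"
    and diff: "\<And>x. l differentiable (at x)"
    and target: "target \<noteq> 0"
    and oracle_unique: "\<And>\<beta>. block_oracle l (same_component target) \<beta> \<longleftrightarrow> \<beta> = \<beta>o"
    and oracle_grad: "restr (same_component target) (gradient l \<beta>o) = 0"
    and lasso_unique:
      "\<And>w. 0 \<le> w \<Longrightarrow> restr (- same_component target) w = 0 \<Longrightarrow>
         \<exists>!\<beta>. lasso_oracle l (same_component target) w \<beta>"
    and rho: "\<rho> \<ge> 0"
    and first_step: "lla_step l (penalty_deriv a0 \<tau> g) \<beta>0 \<beta>1"
    and i: "eigval (num_components target) (laplacian \<bar>\<beta>0\<bar>) \<le> b1 * \<tau>"
           "eigval (num_components target + 1) (laplacian \<bar>\<beta>0\<bar>) \<ge> b2 * \<tau>"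
  shows
    "(op_norm (laplacian (\<bar>\<beta>0\<bar> - \<bar>target\<bar>)) / target_gap target
          \<le> min \<rho> (1 / 2 ^ 6 * sqrt (a1 / (a0 * real (max_component target)))) \<and>
      (\<forall>\<beta>\<in>B_op l target a0 \<rho> \<tau>.
          infnorm (restr (- same_component target) (gradient l \<beta>))
            < a1 * \<tau> / (4 * real (max_component target)))
      \<longrightarrow>
        \<beta>1 \<in> B_op l target a0 \<rho> \<tau> \<and>
        ((\<forall>\<beta>\<in>B_op l target a0 \<rho> \<tau>. min_component_gap target \<beta> \<ge> b2 * \<tau>)
         \<longrightarrow> (\<forall>\<beta>2. lla_step l (penalty_deriv a0 \<tau> g) \<beta>1 \<beta>2 \<longleftrightarrow> \<beta>2 = \<beta>o) \<and>
             (\<forall>\<beta>3. lla_step l (penalty_deriv a0 \<tau> g) \<beta>o \<beta>3 \<longleftrightarrow> \<beta>3 = \<beta>o)))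
     \<and>
     (min (norm (laplacian (\<bar>\<beta>0\<bar> - \<bar>target\<bar>)))
          (sqrt (real (num_components target)) * op_norm (laplacian (\<bar>\<beta>0\<bar> - \<bar>target\<bar>)))
          \<le> target_gap target
             * min \<rho> (1 / 2 ^ 6 * sqrt (a1 / (a0 * real (max_component target)))) \<and>
      (\<forall>\<beta>\<in>B_F l target a0 \<rho> \<tau>.
          infnorm (restr (- same_component target) (gradient l \<beta>))
            < a1 * \<tau> / (4 * real (max_component target)))
      \<longrightarrow>
        \<beta>1 \<in> B_F l target a0 \<rho> \<tau> \<and>
        ((\<forall>\<beta>\<in>B_F l target a0 \<rho> \<tau>. min_component_gap target \<beta> \<ge> b2 * \<tau>)
         \<longrightarrow> (\<forall>\<beta>2. lla_step l (penalty_deriv a0 \<tau> g) \<beta>1 \<beta>2 \<longleftrightarrow> \<beta>2 = \<beta>o) \<and>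
             (\<forall>\<beta>3. lla_step l (penalty_deriv a0 \<tau> g) \<beta>o \<beta>3 \<longleftrightarrow> \<beta>3 = \<beta>o)))"
proof -
  let ?S = "same_component target" and ?h = "penalty_deriv a0 \<tau> g" and ?d = "real (max_component target)"
  let ?E = "laplacian (\<bar>\<beta>0\<bar> - \<bar>target\<bar>)" and ?\<Delta> = "target_gap target"
  let ?grad = "\<lambda>B. \<forall>\<beta>\<in>B. infnorm (restr (- ?S) (gradient l \<beta>)) < a1 * \<tau> / (4 * ?d)"
  define \<delta> where "\<delta> = min \<rho> (1 / 2 ^ 6 * sqrt (a1 / (a0 * ?d)))"
  have a0: "0 < a0" using \<open>a0 \<ge> a1\<close> \<open>a1 > 0\<close> by linarith
  have d: "1 \<le> ?d" using max_component_pos[of target] by simp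
  obtain w \<mu> where w: "eigenbasis w (laplacian \<bar>target\<bar>) \<mu>"
    using spectral_theorem[OF laplacian_symmetric] .
  note spec = target_spectrum[OF w target]
  obtain V ev where V: "eigen_decomp (laplacian \<bar>\<beta>0\<bar>) V ev"
    and min: "is_arg_min (\<lambda>\<beta>. l \<beta> + weighted_l1 UNIV (eig_weights V (\<chi> k. ?h (ev $ k))) \<beta>) (\<lambda>_. True) \<beta>1"
    using first_step unfolding lla_step_def by blast
  interpret V: eigenbasis "\<lambda>k. column k V" "laplacian \<bar>\<beta>0\<bar>" "\<lambda>k. ev $ k"
    using V by (simp add: eigen_decomp_iff)
  let ?M = "eig_weights V (\<chi> k. ?h (ev $ k))"

  \<comment> \<open>The sign of \<open>\<tau>\<close> is forced: (i) bounds an eigenvalue of a positive semidefinite matrix by \<open>b1 * \<tau>\<close>,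
    and the strict gradient bound at the block oracle later excludes \<open>\<tau> = 0\<close>.\<close>
  have "0 \<le> b1 * \<tau>"
  proof -
    have "num_components target \<le> card {k. ev $ k \<le> eigval (num_components target) (laplacian \<bar>\<beta>0\<bar>)}"
      using num_components_pos[of target] spec(3) by (intro V.card_le_eigval) auto
    then have "card {k. ev $ k \<le> eigval (num_components target) (laplacian \<bar>\<beta>0\<bar>)} \<noteq> 0"
      using num_components_pos[of target] by linarith
    then have "{k. ev $ k \<le> eigval (num_components target) (laplacian \<bar>\<beta>0\<bar>)} \<noteq> {}"
      by (rule contrapos_nn) (simp only: card.empty)
    then obtain k where "ev $ k \<le> eigval (num_components target) (laplacian \<bar>\<beta>0\<bar>)" by blast
    then show ?thesis
      using eigenbasis_laplacian_nonneg[OF V.eigenbasis_axioms, of k] i(1) by linarith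
  qed
  then have \<tau>0: "0 \<le> \<tau>" using \<open>b1 > 0\<close> by (simp add: zero_le_mult_iff)
  have \<beta>o0: "lasso_oracle l ?S 0 \<beta>o"
    using oracle_unique by (simp add: lasso_oracle_zero_weight)
  have restr0: "restr (- ?S) (0 :: real^('n edge)) = 0"
    by (simp add: restr_eq_0_iff)

  have \<delta>0: "0 \<le> \<delta>" and \<delta>\<rho>: "\<delta> \<le> \<rho>"
    using rho a0 \<open>a1 > 0\<close> d by (simp_all add: \<delta>_def)
  have \<delta>d: "\<delta> * sqrt ?d \<le> 1 / 2 ^ 6"
  proof -
    have "\<delta> * sqrt ?d \<le> 1 / 2 ^ 6 * sqrt (a1 / (a0 * ?d)) * sqrt ?d"
      unfolding \<delta>_def using d by (intro mult_right_mono) auto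
    also have "\<dots> = 1 / 2 ^ 6 * sqrt (a1 / a0)"
      using d by (simp add: real_sqrt_mult[symmetric] del: real_sqrt_mult)
    also have "\<dots> \<le> 1 / 2 ^ 6 * 1"
      using \<open>a0 \<ge> a1\<close> a0 by (intro mult_left_mono) (simp_all add: divide_le_eq)
    finally show ?thesis by simp
  qed
  have \<delta>2: "c * \<delta>\<^sup>2 \<le> c * \<rho>\<^sup>2" if "0 \<le> c" for c
    using that \<delta>0 \<delta>\<rho> by (intro mult_left_mono power_mono) auto

  have step: "first_step target \<beta>0 V ev ?h (a1 * \<tau>) (a0 * \<tau>) (b1 * \<tau>) (b2 * \<tau>) \<delta>"
    if \<tau>: "0 < \<tau>" and op: "op_norm ?E \<le> ?\<Delta> * \<delta>"
  proof
    show "b1 * \<tau> < b2 * \<tau>" using \<tau> \<open>b2 > b1\<close> by simp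
    show "a1 * \<tau> \<le> ?h c \<and> ?h c \<le> a0 * \<tau>" if "0 \<le> c" "c \<le> b1 * \<tau>" for c
    proof
      show "?h c \<le> a0 * \<tau>" by (rule penalty_deriv_le[OF scad \<open>0 \<le> c\<close>])
      show "a1 * \<tau> \<le> ?h c"
        using that scad \<open>a0 \<ge> a1\<close> \<tau>
        by (cases "c = 0") (auto simp: scad_like_def penalty_deriv_def)
    qed
    show "?h c = 0" if "b2 * \<tau> \<le> c" for c
    proof -
      have "0 < b2 * \<tau>" using \<tau> \<open>b2 > b1\<close> \<open>b1 > 0\<close> by simp
      then show ?thesis using that scad by (auto simp: scad_like_def)
    qed
  qed (use target V i \<tau> a0 \<open>a1 > 0\<close> \<delta>0 \<delta>d op in auto)

  have M_S: "0 \<le> restr ?S ?M" "restr (- ?S) (restr ?S ?M) = 0" if "0 \<le> ?M"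
    using that by (auto simp: less_eq_vec_def restr_def vec_eq_iff)

  have w_max: "\<bar>restr ?S ?M $ e\<bar> \<le> 2 ^ 5 * a0 * \<tau> * \<rho>\<^sup>2"
    if \<tau>: "0 < \<tau>" and op: "op_norm ?E \<le> ?\<Delta> * \<delta>" for e
  proof (cases "e \<in> ?S")
    case True
    interpret first_step target \<beta>0 V ev ?h "a1 * \<tau>" "a0 * \<tau>" "b1 * \<tau>" "b2 * \<tau>" \<delta>
      by (rule step[OF \<tau> op])
    have "?M $ e \<le> 2 ^ 5 * (a0 * \<tau>) * \<delta>\<^sup>2"
      by (rule weight_within_component[OF True])
    also have "\<dots> \<le> 2 ^ 5 * (a0 * \<tau>) * \<rho>\<^sup>2"
      using a0 \<tau> by (intro \<delta>2) simp
    finally have "?M $ e \<le> 2 ^ 5 * a0 * \<tau> * \<rho>\<^sup>2" by (simp add: mult.assoc)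
    then show ?thesis
      using True weight_nonneg by (simp add: restr_def less_eq_vec_def)
  qed (use a0 \<tau>0 in \<open>simp add: restr_def\<close>)

  \<comment> \<open>The two parts differ only in the set \<open>B\<close>: it must contain the block oracle and all solutions of the
    Lasso block oracle problem with the weights of the first step.\<close>
  have conclusion: "\<beta>1 \<in> B \<and> ((\<forall>\<beta>\<in>B. min_component_gap target \<beta> \<ge> b2 * \<tau>)
         \<longrightarrow> (\<forall>\<beta>2. lla_step l ?h \<beta>1 \<beta>2 \<longleftrightarrow> \<beta>2 = \<beta>o) \<and> (\<forall>\<beta>3. lla_step l ?h \<beta>o \<beta>3 \<longleftrightarrow> \<beta>3 = \<beta>o))"
    if grad: "?grad B" and op: "op_norm ?E \<le> ?\<Delta> * \<delta>" and \<beta>o: "\<beta>o \<in> B"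
      and supp: "\<And>\<beta>. \<beta> \<in> B \<Longrightarrow> restr (- ?S) \<beta> = 0"
      and in_B: "\<And>\<beta>. 0 < \<tau> \<Longrightarrow> lasso_oracle l ?S (restr ?S ?M) \<beta> \<Longrightarrow> \<beta> \<in> B" for B
  proof -
    have "0 < a1 * \<tau> / (4 * ?d)"
      using grad \<beta>o infnorm_pos_le by (metis order_le_less_trans)
    then have \<tau>: "0 < \<tau>" using d \<open>a1 > 0\<close> by (simp add: zero_less_divide_iff zero_less_mult_iff)
    interpret first_step target \<beta>0 V ev ?h "a1 * \<tau>" "a0 * \<tau>" "b1 * \<tau>" "b2 * \<tau>" \<delta>
      by (rule step[OF \<tau> op])
    have \<beta>1: "\<beta>1 \<in> B"
    proof (rule lla_step_into_lasso_oracles[OF convex diff _ weight_nonneg weight_between_components in_B[OF \<tau>] _ min])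
      show "\<exists>\<beta>. lasso_oracle l ?S (restr ?S ?M) \<beta>"
        using lasso_unique[OF M_S[OF weight_nonneg]] by blast
      show "infnorm (restr (- ?S) (gradient l \<beta>)) < a1 * \<tau> / (2 * ?d) / 2" if "\<beta> \<in> B" for \<beta>
        using grad that by simp
    qed
    have grad_o: "infnorm (restr (- ?S) (gradient l \<beta>o)) < a0 * \<tau> / (2 * ?d)"
    proof -
      have "a1 * \<tau> / (4 * ?d) \<le> a0 * \<tau> / (2 * ?d)"
        using \<open>a0 \<ge> a1\<close> \<open>a1 > 0\<close> \<tau> d by (intro frac_le mult_right_mono) auto
      then show ?thesis using grad \<beta>o by fastforce
    qed
    have "lla_step l ?h b \<beta> \<longleftrightarrow> \<beta> = \<beta>o"
      if "b \<in> B" "\<forall>\<beta>\<in>B. min_component_gap target \<beta> \<ge> b2 * \<tau>" for b \<beta>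
    proof (rule lla_step_from_well_separated_blocks[OF convex diff oracle_unique grad_o supp[OF that(1)]])
      show "0 < b2 * \<tau>" using \<tau> \<open>b2 > b1\<close> \<open>b1 > 0\<close> by simp
      show "?h 0 = a0 * \<tau>" by (simp add: penalty_deriv_def)
    qed (use that a0 \<tau> h_high in auto)
    with \<beta>1 \<beta>o show ?thesis by blast
  qed

  have part_op: "\<beta>1 \<in> B_op l target a0 \<rho> \<tau> \<and> ((\<forall>\<beta>\<in>B_op l target a0 \<rho> \<tau>. min_component_gap target \<beta> \<ge> b2 * \<tau>)
         \<longrightarrow> (\<forall>\<beta>2. lla_step l ?h \<beta>1 \<beta>2 \<longleftrightarrow> \<beta>2 = \<beta>o) \<and> (\<forall>\<beta>3. lla_step l ?h \<beta>o \<beta>3 \<longleftrightarrow> \<beta>3 = \<beta>o))"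
    if E: "op_norm ?E / ?\<Delta> \<le> \<delta>" and grad: "?grad (B_op l target a0 \<rho> \<tau>)"
  proof -
    have op: "op_norm ?E \<le> ?\<Delta> * \<delta>"
      using E spec(4) by (simp add: divide_le_eq mult.commute)
    have "\<beta>o \<in> B_op l target a0 \<rho> \<tau>"
      unfolding B_op_def using a0 \<tau>0 \<beta>o0 restr0
      by (intro CollectI exI[of _ 0]) (simp add: infnorm_0)
    moreover have "restr (- ?S) \<beta> = 0" if "\<beta> \<in> B_op l target a0 \<rho> \<tau>" for \<beta>
      using that by (auto simp: B_op_def lasso_oracle_iff)
    moreover have "\<beta> \<in> B_op l target a0 \<rho> \<tau>"
      if \<tau>: "0 < \<tau>" and "lasso_oracle l ?S (restr ?S ?M) \<beta>" for \<beta>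
    proof -
      interpret first_step target \<beta>0 V ev ?h "a1 * \<tau>" "a0 * \<tau>" "b1 * \<tau>" "b2 * \<tau>" \<delta>
        by (rule step[OF \<tau> op])
      have "infnorm (restr ?S ?M) \<le> 2 ^ 5 * a0 * \<tau> * \<rho>\<^sup>2"
        by (rule infnorm_le) (rule w_max[OF \<tau> op])
      then show ?thesis
        unfolding B_op_def using that(2) M_S[OF weight_nonneg] by blast
    qed
    ultimately show ?thesis by (intro conclusion[OF grad op]) blast+
  qed

  have part_F: "\<beta>1 \<in> B_F l target a0 \<rho> \<tau> \<and> ((\<forall>\<beta>\<in>B_F l target a0 \<rho> \<tau>. min_component_gap target \<beta> \<ge> b2 * \<tau>)
         \<longrightarrow> (\<forall>\<beta>2. lla_step l ?h \<beta>1 \<beta>2 \<longleftrightarrow> \<beta>2 = \<beta>o) \<and> (\<forall>\<beta>3. lla_step l ?h \<beta>o \<beta>3 \<longleftrightarrow> \<beta>3 = \<beta>o))"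
    if F: "min (norm ?E) (sqrt (num_components target) * op_norm ?E) \<le> ?\<Delta> * \<delta>"
      and grad: "?grad (B_F l target a0 \<rho> \<tau>)"
  proof -
    have op0: "0 \<le> op_norm ?E"
      unfolding op_norm_def by (rule onorm_pos_le[OF matrix_vector_mul_bounded_linear])
    have "1 * op_norm ?E \<le> sqrt (num_components target) * op_norm ?E"
      using op0 num_components_pos[of target] by (intro mult_right_mono) auto
    then have op: "op_norm ?E \<le> ?\<Delta> * \<delta>"
      using op_norm_le_frobenius[of ?E] F by linarith
    have "0 \<le> 2 powr (9 / 2) * sqrt ?d * a0 * \<tau> * \<rho>\<^sup>2" using a0 \<tau>0 by simp
    then have "\<beta>o \<in> B_F l target a0 \<rho> \<tau>"
      unfolding B_F_def using a0 \<tau>0 \<beta>o0 restr0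
      by (intro CollectI exI[of _ 0]) (simp add: infnorm_0)
    moreover have "restr (- ?S) \<beta> = 0" if "\<beta> \<in> B_F l target a0 \<rho> \<tau>" for \<beta>
      using that by (auto simp: B_F_def lasso_oracle_iff)
    moreover have "\<beta> \<in> B_F l target a0 \<rho> \<tau>"
      if \<tau>: "0 < \<tau>" and "lasso_oracle l ?S (restr ?S ?M) \<beta>" for \<beta>
    proof -
      interpret first_step target \<beta>0 V ev ?h "a1 * \<tau>" "a0 * \<tau>" "b1 * \<tau>" "b2 * \<tau>" \<delta>
        by (rule step[OF \<tau> op])
      let ?w = "restr ?S ?M" and ?c = "a0 * \<tau> * \<rho>\<^sup>2"
      have c: "0 \<le> ?c" using a0 \<tau> by simp
      have w0: "0 \<le> ?w $ e" for e
        using M_S(1)[OF weight_nonneg] by (simp add: less_eq_vec_def)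
      have inf: "infnorm ?w \<le> 2 ^ 5 * a0 * \<tau> * \<rho>\<^sup>2"
        by (rule infnorm_le) (rule w_max[OF \<tau> op])
      have wmax: "?w $ e \<le> 2 ^ 5 * ?c" for e
        using w_max[OF \<tau> op, of e] w0[of e] by (simp add: mult.assoc)
      have "(\<Sum>e\<in>UNIV. \<bar>?w $ e\<bar>) = (\<Sum>e\<in>?S. ?M $ e)"
        using weight_nonneg by (intro sum.mono_neutral_cong_right) (auto simp: restr_def less_eq_vec_def)
      also have "\<dots> \<le> 2 ^ 4 * ?d * (a0 * \<tau>) * \<delta>\<^sup>2"
        by (rule weight_l1_within_components[OF F])
      also have "\<dots> \<le> 2 ^ 4 * ?d * (a0 * \<tau>) * \<rho>\<^sup>2"
        using a0 \<tau> by (intro \<delta>2) simp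
      finally have l1: "(\<Sum>e\<in>UNIV. \<bar>?w $ e\<bar>) \<le> 2 ^ 4 * ?d * ?c" by (simp add: mult.assoc)
      \<comment> \<open>The Euclidean bound is the geometric mean of the other two, as \<open>2 ^ 5 * 2 ^ 4 = (2 powr (9 / 2))\<^sup>2\<close>.\<close>
      have "(norm ?w)\<^sup>2 = (\<Sum>e\<in>UNIV. ?w $ e * \<bar>?w $ e\<bar>)"
        using w0 by (simp add: norm_vec_def L2_set_def sum_nonneg power2_eq_square)
      also have "\<dots> \<le> (\<Sum>e\<in>UNIV. 2 ^ 5 * ?c * \<bar>?w $ e\<bar>)"
        by (intro sum_mono mult_right_mono wmax abs_ge_zero)
      also have "\<dots> \<le> 2 ^ 5 * ?c * (2 ^ 4 * ?d * ?c)"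
        unfolding sum_distrib_left[symmetric] using l1 c by (intro mult_left_mono) auto
      also have "\<dots> = (2 powr (9 / 2) * sqrt ?d * ?c)\<^sup>2"
      proof -
        have "(2 powr (9 / 2))\<^sup>2 = (2 powr 9 :: real)"
          by (simp add: power2_eq_square powr_add[symmetric])
        then have p: "(2 powr (9 / 2))\<^sup>2 = (2 ^ 9 :: real)"
          by (simp add: powr_numeral)
        have "(2 powr (9 / 2) * sqrt ?d * ?c)\<^sup>2 = (2 powr (9 / 2))\<^sup>2 * (sqrt ?d)\<^sup>2 * ?c\<^sup>2"
          by (simp only: power_mult_distrib)
        also have "\<dots> = 2 ^ 9 * ?d * ?c\<^sup>2"
          by (simp only: p real_sqrt_pow2 of_nat_0_le_iff)
        also have "\<dots> = 2 ^ 5 * ?c * (2 ^ 4 * ?d * ?c)"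
          by (simp add: power2_eq_square)
        finally show ?thesis by (rule sym)
      qed
      finally have "norm ?w \<le> 2 powr (9 / 2) * sqrt ?d * ?c"
        by (rule power2_le_imp_le) (intro mult_nonneg_nonneg c, simp_all)
      then have l2: "norm ?w \<le> 2 powr (9 / 2) * sqrt ?d * a0 * \<tau> * \<rho>\<^sup>2"
        by (simp only: mult.assoc)
      have "(\<Sum>e\<in>UNIV. \<bar>?w $ e\<bar>) \<le> 2 ^ 4 * ?d * a0 * \<tau> * \<rho>\<^sup>2"
        using l1 by (simp only: mult.assoc)
      then show ?thesis
        unfolding B_F_def using that(2) M_S[OF weight_nonneg] inf l2 by blast
    qed
    ultimately show ?thesis by (intro conclusion[OF grad op]) blast+
  qed
  show ?thesis
    using part_op part_F unfolding \<delta>_def by blast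
qed

end
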